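(* Let $A\in\mathbb{R}^{m\times n}$, $b\in\mathbb{R}^m$ with $m>n$, let $\widetilde\sigma_1\ge\cdots\ge\widetilde\sigma_n$ be the singular values of $A$ and $\sigma_1\ge\cdots\ge\sigma_{n+1}$ those of $[A,\ b]$, and assume $\widetilde\sigma_n>\sigma_{n+1}$. Let $x$ be the total least squares solution for $(A,b)$ and $r=b-Ax$, and assume $x\ne0$ and $r\neq 0$. Then the three condition numbers $K_{\mathrm{ZLWQ}}$, $K_{\mathrm{BG}}$, $K_{\mathrm{LJ}}$ defined in the context coincide: $$K_{\mathrm{ZLWQ}}=K_{\mathrm{BG}}=K_{\mathrm{LJ}}.$$
   Context: The total least squares (TLS) problem for $(A,b)$ is $\min\|[E\ f]\|_F$ subject to $b+f\in\mathscr{R}(A+E)$ (range); a TLS solution is an $x$ with $(A+E)x=b+f$ for a minimizing $[E\ f]$. Under $\widetilde\sigma_n>\sigma_{n+1}$ it exists, is unique, and equals $x=(A^{\mathrm T}A-\sigma_{n+1}^2I_n)^{-1}A^{\mathrm T}b$. Let $[A,\ b]=U\,\mathrm{diag}(\sigma_1,\dots,\sigma_{n+1})V^{\mathrm T}$ be a (thin) singular value decomposition with $U\in\mathbb{R}^{m\times(n+1)}$, $V\in\mathbb{R}^{(n+1)\times(n+1)}$, let $u_{n+1},v_{n+1}$ be the last columns of $U,V$, and let $A=\widetilde U\,\mathrm{diag}(\widetilde\sigma_1,\dots,\widetilde\sigma_n)\widetilde V^{\mathrm T}$ be a (thin) singular value decomposition of $A$, with $\widetilde V\in\mathbb{R}^{n\times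 n}$ orthogonal. $\otimes$ is the Kronecker product, $(a_{ij})\otimes B=(a_{ij}B)$; $\|\cdot\|_2$ is the spectral/Euclidean norm, $\|\cdot\|_F$ the Frobenius norm. (1) With $K=(A^{\mathrm T}A-\sigma_{n+1}^2I_n)^{-1}$, $y=Kx$, $$M=\left[K\otimes b^{\mathrm T}-x^{\mathrm T}\otimes(KA^{\mathrm T})-K\otimes(Ax)^{\mathrm T},\ \ KA^{\mathrm T}\right],\qquad N=2\sigma_{n+1}\,y\,(v_{n+1}^{\mathrm T}\otimes u_{n+1}^{\mathrm T}),$$ define $K_{\mathrm{ZLWQ}}=\dfrac{\|M+N\|_2\,\|[A,\ b]\|_F}{\|x\|_2}$. (2) With $\widetilde D=\mathrm{diag}\left((\widetilde\sigma_1^2-\sigma_{n+1}^2)^{-1},\dots,(\widetilde\sigma_n^2-\sigma_{n+1}^2)^{-1}\right)$ and $D=\mathrm{diag}\left(\sqrt{\sigma_1^2+\sigma_{n+1}^2},\dots,\sqrt{\sigma_n^2+\sigma_{n+1}^2}\right)$, define $$K_{\mathrm{BG}}=\sqrt{1+\|x\|_2^2}\ \left\|\widetilde D\,[\widetilde V^{\mathrm T},\ \mathbf 0_{n\times1}]\,V\,[D,\ \mathbf 0_{n\times1}]^{\mathrm T}\right\|_2\frac{\|[A,\ b]\|_F}{\|x\|_2}.$$ (3) With $G(x)=[x^{\mathrm T},\ -1]\otimes I_m$, define $$K_{\mathrm{LJ}}=\frac{\left\|(A^{\mathrm T}A-\sigma_{n+1}^2I_n)^{-1}\left(2A^{\mathrm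 T}\frac{r}{\|r\|_2}\frac{r^{\mathrm T}}{\|r\|_2}G(x)-A^{\mathrm T}G(x)+[I_n\otimes r^{\mathrm T},\ \mathbf 0_{n\times m}]\right)\right\|_2\|[A,\ b]\|_F}{\|x\|_2}.$$ *)

theory Defs
  imports Complex_Main "Jordan_Normal_Form.Gauss_Jordan_Elimination"
begin

definition row_mat :: "'a vec \<Rightarrow> 'a mat" where
  "row_mat v = mat_of_rows (dim_vec v) [v]"

definition col_mat :: "'a vec \<Rightarrow> 'a mat" where
  "col_mat v = mat_of_cols (dim_vec v) [v]"

definition append_cols :: "'a::zero mat \<Rightarrow> 'a mat \<Rightarrow> 'a mat" (infixr \<open>@\<^sub>c\<close> 65) where
  "A @\<^sub>c B = four_block_mat A B (0\<^sub>m 0 (dim_col A)) (0\<^sub>m 0 (dim_col B))"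

definition kron :: "'a::times mat \<Rightarrow> 'a mat \<Rightarrow> 'a mat" where
  "kron A B = mat (dim_row A * dim_row B) (dim_col A * dim_col B)
     (\<lambda>(i, j). A $$ (i div dim_row B, j div dim_col B) * B $$ (i mod dim_row B, j mod dim_col B))"

definition norm2_vec :: "real vec \<Rightarrow> real" where
  "norm2_vec v = sqrt (v \<bullet> v)"

definition frob_norm :: "real mat \<Rightarrow> real" where
  "frob_norm A = sqrt (\<Sum>i<dim_row A. \<Sum>j<dim_col A. (A $$ (i, j))\<^sup>2)"

definition spectral_norm :: "real mat \<Rightarrow> real" where
  "spectral_norm A = (SUP v \<in> {v \<in> carrier_vec (dim_col A). norm2_vec v \<le> 1}. norm2_vec (A *\<^sub>v v))"

definition mat_range :: "real mat \<Rightarrow> real vec set" where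
  "mat_range A = {A *\<^sub>v x | x. x \<in> carrier_vec (dim_col A)}"

(* Singular values are indexed from 0: s 0, ..., s (k - 1), in decreasing order. *)
definition thin_svd :: "nat \<Rightarrow> nat \<Rightarrow> real mat \<Rightarrow> real mat \<Rightarrow> (nat \<Rightarrow> real) \<Rightarrow> real mat \<Rightarrow> bool" where
  "thin_svd m k C U s V \<longleftrightarrow>
     U \<in> carrier_mat m k \<and> V \<in> carrier_mat k k \<and>
     U\<^sup>T * U = 1\<^sub>m k \<and> V\<^sup>T * V = 1\<^sub>m k \<and>
     (\<forall>i<k. 0 \<le> s i) \<and> (\<forall>i j. i \<le> j \<and> j < k \<longrightarrow> s j \<le> s i) \<and>
     C = U * mat_diag k s * V\<^sup>T"

definition tls_feasible :: "real mat \<Rightarrow> real vec \<Rightarrow> real mat \<Rightarrow> real vec \<Rightarrow> bool" where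
  "tls_feasible A b E f \<longleftrightarrow>
     E \<in> carrier_mat (dim_row A) (dim_col A) \<and> f \<in> carrier_vec (dim_row A) \<and>
     b + f \<in> mat_range (A + E)"

definition tls_minimizer :: "real mat \<Rightarrow> real vec \<Rightarrow> real mat \<Rightarrow> real vec \<Rightarrow> bool" where
  "tls_minimizer A b E f \<longleftrightarrow> tls_feasible A b E f \<and>
     (\<forall>E' f'. tls_feasible A b E' f' \<longrightarrow>
        frob_norm (E @\<^sub>c col_mat f) \<le> frob_norm (E' @\<^sub>c col_mat f'))"

definition tls_solution :: "real mat \<Rightarrow> real vec \<Rightarrow> real vec \<Rightarrow> bool" where
  "tls_solution A b x \<longleftrightarrow> x \<in> carrier_vec (dim_col A) \<and>
     (\<exists>E f. tls_minimizer A b E f \<and> (A + E) *\<^sub>v x = b + f)"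

(* From here on the argument t is the smallest singular value of [A, b]. *)
definition tls_inv :: "real mat \<Rightarrow> real \<Rightarrow> real mat" where
  "tls_inv A t = the (mat_inverse (A\<^sup>T * A - t\<^sup>2 \<cdot>\<^sub>m 1\<^sub>m (dim_col A)))"

definition M_ZLWQ :: "real mat \<Rightarrow> real vec \<Rightarrow> real vec \<Rightarrow> real \<Rightarrow> real mat" where
  "M_ZLWQ A b x t = (let K = tls_inv A t in
     (kron K (row_mat b) - kron (row_mat x) (K * A\<^sup>T) - kron K (row_mat (A *\<^sub>v x)))
       @\<^sub>c (K * A\<^sup>T))"

(* u and v are the last columns of U and V in the singular value decomposition of [A, b]. *)
definition N_ZLWQ :: "real mat \<Rightarrow> real vec \<Rightarrow> real \<Rightarrow> real vec \<Rightarrow> real vec \<Rightarrow> real mat" where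
  "N_ZLWQ A x t u v = (let y = tls_inv A t *\<^sub>v x in
     (2 * t) \<cdot>\<^sub>m (col_mat y * kron (row_mat v) (row_mat u)))"

definition K_ZLWQ :: "real mat \<Rightarrow> real vec \<Rightarrow> real vec \<Rightarrow> real \<Rightarrow> real vec \<Rightarrow> real vec \<Rightarrow> real" where
  "K_ZLWQ A b x t u v =
     spectral_norm (M_ZLWQ A b x t + N_ZLWQ A x t u v) * frob_norm (A @\<^sub>c col_mat b) / norm2_vec x"

(* st, Vt come from the decomposition of A, and s, V from that of [A, b]. *)
definition K_BG :: "real mat \<Rightarrow> real vec \<Rightarrow> real vec \<Rightarrow> (nat \<Rightarrow> real) \<Rightarrow> real mat
    \<Rightarrow> (nat \<Rightarrow> real) \<Rightarrow> real mat \<Rightarrow> real" where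
  "K_BG A b x st Vt s V = (let n = dim_col A;
       Dt = mat_diag n (\<lambda>i. inverse ((st i)\<^sup>2 - (s n)\<^sup>2));
       D = mat_diag n (\<lambda>i. sqrt ((s i)\<^sup>2 + (s n)\<^sup>2))
     in sqrt (1 + (norm2_vec x)\<^sup>2)
        * spectral_norm (Dt * (Vt\<^sup>T @\<^sub>c 0\<^sub>m n 1) * V * (D @\<^sub>c 0\<^sub>m n 1)\<^sup>T)
        * (frob_norm (A @\<^sub>c col_mat b) / norm2_vec x))"

definition G_LJ :: "nat \<Rightarrow> real vec \<Rightarrow> real mat" where
  "G_LJ m x = kron (row_mat x @\<^sub>c (- 1\<^sub>m 1)) (1\<^sub>m m)"

definition K_LJ :: "real mat \<Rightarrow> real vec \<Rightarrow> real vec \<Rightarrow> real \<Rightarrow> real" where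
  "K_LJ A b x t = (let m = dim_row A; n = dim_col A;
       r = b - A *\<^sub>v x;
       e = inverse (norm2_vec r) \<cdot>\<^sub>v r
     in spectral_norm (tls_inv A t *
          (2 \<cdot>\<^sub>m (A\<^sup>T * col_mat e * row_mat e * G_LJ m x) - A\<^sup>T * G_LJ m x
            + (kron (1\<^sub>m n) (row_mat r) @\<^sub>c 0\<^sub>m n m)))
        * frob_norm (A @\<^sub>c col_mat b) / norm2_vec x)"

end

theory Submission
  imports Defs "Jordan_Normal_Form.Determinant"
begin

text \<open>
  Write \<open>\<sigma>\<close> for the smallest singular value of \<open>[A, b]\<close>, with singular vectors \<open>u\<close>, \<open>v\<close>, and let
  \<open>w = (x, -1)\<close>. Minimality of the TLS correction gives \<open>\<parallel>[A, b] w\<parallel> \<le> \<sigma> \<parallel>w\<parallel>\<close>, so \<open>w\<close> lies in the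
  bottom singular space, which the gap condition makes one-dimensional. Hence \<open>v = \<alpha> w\<close>,
  \<open>\<sigma> u = - \<alpha> r\<close>, \<open>A\<^sup>T r = - \<sigma>\<^sup>2 x\<close> and \<open>\<parallel>r\<parallel>\<^sup>2 = \<sigma>\<^sup>2 \<parallel>w\<parallel>\<^sup>2\<close>. With these identities the matrices
  inside the norms of \<open>K_ZLWQ\<close> and \<open>K_LJ\<close> are literally the same matrix \<open>L = K Q\<close>.
  For \<open>p = K z\<close> one computes
  \<open>\<parallel>L\<^sup>T z\<parallel>\<^sup>2 = \<parallel>w\<parallel>\<^sup>2 \<parallel>A p\<parallel>\<^sup>2 - 2 \<sigma>\<^sup>2 (x \<bullet> p)\<^sup>2 + \<sigma>\<^sup>2 \<parallel>w\<parallel>\<^sup>2 \<parallel>p\<parallel>\<^sup>2\<close>, which is \<open>\<parallel>w\<parallel>\<^sup>2\<close> times the squared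
  norm of the transposed matrix \<open>B\<close> of \<open>K_BG\<close> applied to the rotated vector \<open>Vt\<^sup>T z\<close>. As the spectral
  norm is invariant under transposition and rotation, \<open>\<parallel>L\<parallel> = \<parallel>w\<parallel> \<parallel>B\<parallel>\<close>.
\<close>

section \<open>The spectral norm\<close>

text \<open>Lagrange's identity: the defect of the inequality is half the double sum of the squares
  of x_i y_j - x_j y_i.\<close>

lemma scalar_prod_cauchy_schwarz:
  fixes x y :: "real vec"
  assumes "x \<in> carrier_vec k" "y \<in> carrier_vec k"
  shows "(x \<bullet> y)\<^sup>2 \<le> (x \<bullet> x) * (y \<bullet> y)"
proof -
  have e: "(\<Sum>i\<in>{0..<k}. (x $ i)\<^sup>2) * (\<Sum>j\<in>{0..<k}. (y $ j)\<^sup>2) - (\<Sum>i\<in>{0..<k}. x $ i * y $ i)\<^sup>2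
     = (\<Sum>i\<in>{0..<k}. \<Sum>j\<in>{0..<k}. (x $ i * y $ j - x $ j * y $ i)\<^sup>2) / 2"
  proof -
    have "(\<Sum>i\<in>{0..<k}. \<Sum>j\<in>{0..<k}. (x $ i * y $ j - x $ j * y $ i)\<^sup>2)
      = (\<Sum>i\<in>{0..<k}. \<Sum>j\<in>{0..<k}. (x $ i)\<^sup>2 * (y $ j)\<^sup>2) + (\<Sum>i\<in>{0..<k}. \<Sum>j\<in>{0..<k}. (y $ i)\<^sup>2 * (x $ j)\<^sup>2)
        - 2 * (\<Sum>i\<in>{0..<k}. \<Sum>j\<in>{0..<k}. (x $ i * y $ i) * (x $ j * y $ j))"
      by (simp add: sum.distrib[symmetric] sum_subtractf[symmetric] sum_distrib_left
        power2_eq_square algebra_simps)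
    then show ?thesis
      by (simp add: sum_product[symmetric] power2_eq_square)
  qed
  have "0 \<le> (\<Sum>i\<in>{0..<k}. \<Sum>j\<in>{0..<k}. (x $ i * y $ j - x $ j * y $ i)\<^sup>2) / 2"
    by (intro divide_nonneg_nonneg sum_nonneg) auto
  with e show ?thesis
    using assms by (simp add: scalar_prod_def power2_eq_square)
qed

lemma scalar_prod_self_nonneg: "0 \<le> (x :: real vec) \<bullet> x"
  by (simp add: scalar_prod_def sum_nonneg)

lemma scalar_prod_self_eq_0:
  fixes x :: "real vec"
  assumes "x \<in> carrier_vec k" "x \<bullet> x = 0"
  shows "x = 0\<^sub>v k"
proof (rule eq_vecI)
  fix i assume i: "i < dim_vec (0\<^sub>v k :: real vec)"
  have "(\<Sum>i\<in>{0..<k}. x $ i * x $ i) = 0"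
    using assms by (simp add: scalar_prod_def)
  then have "x $ i * x $ i = 0"
    using i by (subst (asm) sum_nonneg_eq_0_iff) auto
  then show "x $ i = 0\<^sub>v k $ i" using i by simp
qed (use assms in auto)

lemma norm2_vec_nonneg [simp]: "0 \<le> norm2_vec x"
  by (simp add: norm2_vec_def scalar_prod_self_nonneg)

lemma norm2_vec_sq: "(norm2_vec x)\<^sup>2 = x \<bullet> x"
  by (simp add: norm2_vec_def scalar_prod_self_nonneg)

lemma scalar_prod_le_norm2:
  assumes "x \<in> carrier_vec k" "y \<in> carrier_vec k"
  shows "x \<bullet> y \<le> norm2_vec x * norm2_vec y"
proof -
  have "(x \<bullet> y)\<^sup>2 \<le> (norm2_vec x * norm2_vec y)\<^sup>2"
    using scalar_prod_cauchy_schwarz[OF assms] by (simp add: power_mult_distrib norm2_vec_sq)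
  then show ?thesis by (rule power2_le_imp_le) simp
qed

lemma norm2_vec_smult: "norm2_vec (c \<cdot>\<^sub>v x) = \<bar>c\<bar> * norm2_vec x"
proof -
  have "(c \<cdot>\<^sub>v x) \<bullet> (c \<cdot>\<^sub>v x) = c\<^sup>2 * (x \<bullet> x)"
    by (simp add: scalar_prod_def sum_distrib_left power2_eq_square algebra_simps)
  then show ?thesis by (simp add: norm2_vec_def real_sqrt_mult)
qed

lemma frob_norm_sq: "(frob_norm A)\<^sup>2 = (\<Sum>i<dim_row A. row A i \<bullet> row A i)"
  by (simp add: frob_norm_def sum_nonneg scalar_prod_def power2_eq_square atLeast0LessThan)

text \<open>Cauchy-Schwarz applied row by row. The bound makes the supremum in
  \<open>spectral_norm\<close> finite and later controls [E, f] w for a TLS correction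
  [E, f].\<close>

lemma norm2_mult_le_frob:
  assumes "v \<in> carrier_vec (dim_col A)"
  shows "norm2_vec (A *\<^sub>v v) \<le> frob_norm A * norm2_vec v"
proof -
  have "(norm2_vec (A *\<^sub>v v))\<^sup>2 = (\<Sum>i<dim_row A. (row A i \<bullet> v)\<^sup>2)"
    by (simp only: norm2_vec_sq) (simp add: scalar_prod_def[of "A *\<^sub>v v"] power2_eq_square atLeast0LessThan)
  also have "\<dots> \<le> (\<Sum>i<dim_row A. (row A i \<bullet> row A i) * (v \<bullet> v))"
    using assms by (intro sum_mono scalar_prod_cauchy_schwarz[of _ "dim_col A"]) auto
  also have "\<dots> = (frob_norm A * norm2_vec v)\<^sup>2"
    by (simp add: power_mult_distrib frob_norm_sq norm2_vec_sq sum_distrib_right)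
  finally show ?thesis
    by (rule power2_le_imp_le) (simp add: frob_norm_def sum_nonneg)
qed

text \<open>A real \<open>SUP\<close> can be used as an upper bound only for a set that is bounded
  above; the Frobenius norm supplies such a bound.\<close>

lemma bdd_above_spectral_norm:
  "bdd_above ((\<lambda>v. norm2_vec (A *\<^sub>v v)) ` {v \<in> carrier_vec (dim_col A). norm2_vec v \<le> 1})"
proof (rule bdd_aboveI2)
  fix v assume v: "v \<in> {v \<in> carrier_vec (dim_col A). norm2_vec v \<le> 1}"
  have "norm2_vec (A *\<^sub>v v) \<le> frob_norm A * norm2_vec v"
    using v by (intro norm2_mult_le_frob) simp
  also have "\<dots> \<le> frob_norm A * 1"
    using v by (intro mult_left_mono) (auto simp: frob_norm_def sum_nonneg)
  finally show "norm2_vec (A *\<^sub>v v) \<le> frob_norm A" by simp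
qed

lemma norm2_le_spectral_norm_unit:
  assumes "v \<in> carrier_vec (dim_col A)" "norm2_vec v \<le> 1"
  shows "norm2_vec (A *\<^sub>v v) \<le> spectral_norm A"
  unfolding spectral_norm_def using assms by (intro cSUP_upper[OF _ bdd_above_spectral_norm]) simp

lemma norm2_vec_zero [simp]: "norm2_vec (0\<^sub>v k) = 0"
  by (simp add: norm2_vec_def)

lemma spectral_norm_nonneg: "0 \<le> spectral_norm A"
  using norm2_le_spectral_norm_unit[of "0\<^sub>v (dim_col A)" A] order_trans[OF norm2_vec_nonneg]
  by simp

lemma norm2_mult_le_spectral_norm:
  assumes v: "v \<in> carrier_vec (dim_col A)"
  shows "norm2_vec (A *\<^sub>v v) \<le> spectral_norm A * norm2_vec v"
proof (cases "norm2_vec v = 0")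
  case True
  with v have v0: "v = 0\<^sub>v (dim_col A)"
    by (intro scalar_prod_self_eq_0) (auto simp: norm2_vec_def)
  have "A *\<^sub>v v = 0\<^sub>v (dim_row A)" unfolding v0 by (intro eq_vecI) auto
  with True show ?thesis by simp
next
  case False
  then have pos: "norm2_vec v > 0" using norm2_vec_nonneg[of v] by linarith
  let ?c = "inverse (norm2_vec v)"
  have "norm2_vec (A *\<^sub>v (?c \<cdot>\<^sub>v v)) \<le> spectral_norm A"
    using v pos by (intro norm2_le_spectral_norm_unit) (auto simp: norm2_vec_smult)
  also have "A *\<^sub>v (?c \<cdot>\<^sub>v v) = ?c \<cdot>\<^sub>v (A *\<^sub>v v)"
    using v by (intro mult_mat_vec) auto
  finally show ?thesis using pos by (simp add: norm2_vec_smult field_simps)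
qed

lemma spectral_norm_le:
  assumes "\<And>v. v \<in> carrier_vec (dim_col A) \<Longrightarrow> norm2_vec (A *\<^sub>v v) \<le> c * norm2_vec v" "0 \<le> c"
  shows "spectral_norm A \<le> c"
  unfolding spectral_norm_def
proof (rule cSUP_least)
  have "0\<^sub>v (dim_col A) \<in> {v \<in> carrier_vec (dim_col A). norm2_vec v \<le> 1}" by simp
  then show "{v \<in> carrier_vec (dim_col A). norm2_vec v \<le> 1} \<noteq> {}" by blast
next
  fix v assume v: "v \<in> {v \<in> carrier_vec (dim_col A). norm2_vec v \<le> 1}"
  then have "norm2_vec (A *\<^sub>v v) \<le> c * norm2_vec v" using assms by simp
  also have "\<dots> \<le> c * 1" using v assms(2) by (intro mult_left_mono) auto
  finally show "norm2_vec (A *\<^sub>v v) \<le> c" by simp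
qed

text \<open>Write |A v|^2 as (A^T A v) . v, estimate it by |A^T| |A v| |v| and cancel |A v|. Used
  for A and for A^T, it gives equality of the two norms.\<close>

lemma spectral_norm_le_transpose: "spectral_norm A \<le> spectral_norm A\<^sup>T"
proof (rule spectral_norm_le)
  fix v :: "real vec" assume v: "v \<in> carrier_vec (dim_col A)"
  let ?y = "A *\<^sub>v v"
  have "(norm2_vec ?y)\<^sup>2 = (A\<^sup>T *\<^sub>v ?y) \<bullet> v"
    using v by (subst transpose_vec_mult_scalar[of A "dim_row A" "dim_col A"])
      (auto simp: norm2_vec_sq intro: carrier_vecI)
  also have "\<dots> \<le> norm2_vec (A\<^sup>T *\<^sub>v ?y) * norm2_vec v"
    using v by (intro scalar_prod_le_norm2[of _ "dim_col A"]) (auto intro: carrier_vecI)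
  also have "\<dots> \<le> (spectral_norm A\<^sup>T * norm2_vec ?y) * norm2_vec v"
    by (intro mult_right_mono norm2_mult_le_spectral_norm) (auto intro: carrier_vecI)
  finally have *: "norm2_vec ?y * norm2_vec ?y \<le> norm2_vec ?y * (spectral_norm A\<^sup>T * norm2_vec v)"
    by (simp add: power2_eq_square mult_ac)
  show "norm2_vec ?y \<le> spectral_norm A\<^sup>T * norm2_vec v"
  proof (cases "norm2_vec ?y = 0")
    case True then show ?thesis by (simp add: spectral_norm_nonneg)
  next
    case False
    then have "norm2_vec ?y > 0" using norm2_vec_nonneg[of ?y] by linarith
    with * show ?thesis by simp
  qed
qed (rule spectral_norm_nonneg)

lemma spectral_norm_transpose: "spectral_norm A\<^sup>T = spectral_norm A"
  using spectral_norm_le_transpose[of A] spectral_norm_le_transpose[of "A\<^sup>T"] by simp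

section \<open>Isometries and rotation invariance of the spectral norm\<close>

lemma scalar_prod_isometry:
  fixes W :: "real mat"
  assumes W: "W \<in> carrier_mat m k" and orth: "W\<^sup>T * W = 1\<^sub>m k"
    and z: "z \<in> carrier_vec k" and y: "y \<in> carrier_vec k"
  shows "(W *\<^sub>v z) \<bullet> (W *\<^sub>v y) = z \<bullet> y"
proof -
  have "(W *\<^sub>v z) \<bullet> (W *\<^sub>v y) = (W\<^sup>T *\<^sub>v (W *\<^sub>v z)) \<bullet> y"
    using W z y by (subst transpose_vec_mult_scalar[of W m k]) auto
  also have "W\<^sup>T *\<^sub>v (W *\<^sub>v z) = z"
    using W z orth by (simp add: assoc_mult_mat_vec[symmetric, of _ k m _ k])
  finally show ?thesis .
qed

text \<open>L and B may have different numbers of columns, but their transposes both act on vectors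
  of length n and can be compared there. W is a bijective isometry, so the suprema correspond, and
  transposing back leaves the norms unchanged.\<close>

lemma spectral_norm_eq_scaled_orthogonal:
  assumes L: "L \<in> carrier_mat n p" and B: "B \<in> carrier_mat n q" and W: "W \<in> carrier_mat n n"
    and orth: "W * W\<^sup>T = 1\<^sub>m n" and c: "0 \<le> c"
    and eq: "\<And>z. z \<in> carrier_vec n \<Longrightarrow> norm2_vec (L\<^sup>T *\<^sub>v z) = c * norm2_vec (B\<^sup>T *\<^sub>v (W *\<^sub>v z))"
  shows "spectral_norm L = c * spectral_norm B"
proof -
  have orth': "W\<^sup>T * W = 1\<^sub>m n"
    using mat_mult_left_right_inverse[OF W _ orth] W by simp
  have iso: "norm2_vec (W *\<^sub>v z) = norm2_vec z" if z: "z \<in> carrier_vec n" for z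
    using scalar_prod_isometry[OF W orth' z z] by (simp add: norm2_vec_def)
  have "spectral_norm L\<^sup>T \<le> c * spectral_norm B\<^sup>T"
  proof (rule spectral_norm_le)
    fix z :: "real vec" assume "z \<in> carrier_vec (dim_col L\<^sup>T)"
    then have z: "z \<in> carrier_vec n" using L by simp
    have "norm2_vec (B\<^sup>T *\<^sub>v (W *\<^sub>v z)) \<le> spectral_norm B\<^sup>T * norm2_vec (W *\<^sub>v z)"
      using z W B by (intro norm2_mult_le_spectral_norm) simp
    then show "norm2_vec (L\<^sup>T *\<^sub>v z) \<le> c * spectral_norm B\<^sup>T * norm2_vec z"
      using eq[OF z] iso[OF z] c by (simp add: mult.assoc mult_left_mono)
  qed (use c in \<open>simp add: spectral_norm_nonneg\<close>)
  moreover have "c * spectral_norm B\<^sup>T \<le> spectral_norm L\<^sup>T"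
  proof (cases "c = 0")
    case True then show ?thesis by (simp add: spectral_norm_nonneg)
  next
    case False
    with c have c: "c > 0" by simp
    \<comment> \<open>Every z equals W (W^T z), so \<open>eq\<close> at W^T z yields the reverse
      estimate.\<close>
    have "spectral_norm B\<^sup>T \<le> spectral_norm L\<^sup>T / c"
    proof (rule spectral_norm_le)
      fix z :: "real vec" assume "z \<in> carrier_vec (dim_col B\<^sup>T)"
      then have z: "z \<in> carrier_vec n" using B by simp
      then have z': "W\<^sup>T *\<^sub>v z \<in> carrier_vec n" using W by simp
      have z2: "W *\<^sub>v (W\<^sup>T *\<^sub>v z) = z"
        using W z orth by (simp add: assoc_mult_mat_vec[symmetric, of _ n n _ n])
      have "c * norm2_vec (B\<^sup>T *\<^sub>v z) = norm2_vec (L\<^sup>T *\<^sub>v (W\<^sup>T *\<^sub>v z))"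
        using eq[OF z'] z2 by simp
      also have "\<dots> \<le> spectral_norm L\<^sup>T * norm2_vec (W\<^sup>T *\<^sub>v z)"
        using z' L by (intro norm2_mult_le_spectral_norm) simp
      also have "norm2_vec (W\<^sup>T *\<^sub>v z) = norm2_vec z"
        using iso[OF z'] z2 by simp
      finally show "norm2_vec (B\<^sup>T *\<^sub>v z) \<le> spectral_norm L\<^sup>T / c * norm2_vec z"
        using c by (simp add: field_simps)
    qed (use c in \<open>simp add: spectral_norm_nonneg\<close>)
    then show ?thesis using c by (simp add: field_simps)
  qed
  ultimately show ?thesis by (simp add: spectral_norm_transpose)
qed

section \<open>Singular value decompositions\<close>

lemma orthogonal_mat_right:
  assumes "V \<in> carrier_mat k k" "V\<^sup>T * V = (1\<^sub>m k :: real mat)"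
  shows "V * V\<^sup>T = 1\<^sub>m k"
  using assms by (intro mat_mult_left_right_inverse[of "V\<^sup>T" k V]) auto

lemma mat_diag_mult_vec:
  fixes q :: "'a :: comm_semiring_1 vec"
  assumes "q \<in> carrier_vec k"
  shows "mat_diag k f *\<^sub>v q = vec k (\<lambda>i. f i * q $ i)"
proof (rule eq_vecI)
  fix i assume i: "i < dim_vec (vec k (\<lambda>i. f i * q $ i))"
  have "row (mat_diag k f) i \<bullet> q = (\<Sum>j\<in>{0..<k}. if i = j then f j * q $ j else 0)"
    using i assms unfolding scalar_prod_def by (intro sum.cong) (auto simp: mat_diag_def)
  then show "(mat_diag k f *\<^sub>v q) $ i = vec k (\<lambda>i. f i * q $ i) $ i"
    using i by (simp add: mat_diag_def)
qed (simp add: mat_diag_def)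

lemma transpose_mat_diag [simp]: "(mat_diag k f)\<^sup>T = mat_diag k f"
  by (rule eq_matI) (auto simp: mat_diag_def)

text \<open>In the coordinates V^T p the map C is diagonal up to the isometry U. Quadratic
  expressions in p thus become weighted sums, in which singular values can be compared term by
  term.\<close>

lemma thin_svd_norm:
  assumes svd: "thin_svd m k C U s V" and p: "p \<in> carrier_vec k"
  shows "(C *\<^sub>v p) \<bullet> (C *\<^sub>v p) = (\<Sum>i<k. (s i)\<^sup>2 * ((V\<^sup>T *\<^sub>v p) $ i)\<^sup>2)"
    and "p \<bullet> p = (\<Sum>i<k. ((V\<^sup>T *\<^sub>v p) $ i)\<^sup>2)"
proof -
  have U: "U \<in> carrier_mat m k" "U\<^sup>T * U = 1\<^sub>m k" and V: "V \<in> carrier_mat k k" "V\<^sup>T * V = 1\<^sub>m k"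
    and C: "C = U * mat_diag k s * V\<^sup>T"
    using svd by (auto simp: thin_svd_def)
  let ?q = "V\<^sup>T *\<^sub>v p"
  have q: "?q \<in> carrier_vec k" using V p by simp
  have "C *\<^sub>v p = U *\<^sub>v (mat_diag k s *\<^sub>v ?q)"
    unfolding C using U V p
    by (subst assoc_mult_mat_vec[of _ m k _ k], auto)
       (subst assoc_mult_mat_vec[of _ m k _ k], auto)
  then show "(C *\<^sub>v p) \<bullet> (C *\<^sub>v p) = (\<Sum>i<k. (s i)\<^sup>2 * (?q $ i)\<^sup>2)"
    using q by (simp add: mat_diag_mult_vec scalar_prod_isometry[OF U])
      (simp add: scalar_prod_def atLeast0LessThan power2_eq_square mult_ac)
  have "p \<bullet> p = ?q \<bullet> ?q"
    using scalar_prod_isometry[of "V\<^sup>T" k k p p] V p orthogonal_mat_right[OF V] by simp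
  also have "\<dots> = (\<Sum>i<k. (?q $ i)\<^sup>2)"
    using V by (simp add: scalar_prod_def[of ?q] atLeast0LessThan power2_eq_square cong: sum.cong_simp)
  finally show "p \<bullet> p = (\<Sum>i<k. (?q $ i)\<^sup>2)" .
qed

lemma thin_svd_carrier: "thin_svd m k C U s V \<Longrightarrow> C \<in> carrier_mat m k"
  by (auto simp: thin_svd_def intro!: mult_carrier_mat)

lemma thin_svd_mult_V:
  assumes svd: "thin_svd m k C U s V"
  shows "C * V = U * mat_diag k s" and "C\<^sup>T * U = V * mat_diag k s"
proof -
  have U: "U \<in> carrier_mat m k" "U\<^sup>T * U = 1\<^sub>m k" and V: "V \<in> carrier_mat k k" "V\<^sup>T * V = 1\<^sub>m k"
    and C: "C = U * mat_diag k s * V\<^sup>T"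
    using svd by (auto simp: thin_svd_def)
  have US: "U * mat_diag k s \<in> carrier_mat m k" using U by (intro mult_carrier_mat) auto
  show "C * V = U * mat_diag k s"
    unfolding C using US V by (subst assoc_mult_mat[of _ m k _ k _ k]) auto
  have "C\<^sup>T = V * (mat_diag k s * U\<^sup>T)"
    unfolding C using US U V
    by (subst transpose_mult[OF US, of _ k]) (auto simp: transpose_mult[OF U(1) mat_diag_dim])
  then show "C\<^sup>T * U = V * mat_diag k s"
    using U V mult_carrier_mat[OF mat_diag_dim[of k s], of "U\<^sup>T" m]
    by (simp add: assoc_mult_mat[of V k k _ m U k] assoc_mult_mat[OF mat_diag_dim, of "U\<^sup>T" k m U k]
      right_mult_one_mat[OF mat_diag_dim])
qed

lemma thin_svd_singular_vectors:
  assumes svd: "thin_svd m k C U s V" and j: "j < k"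
  shows "C *\<^sub>v col V j = s j \<cdot>\<^sub>v col U j" and "C\<^sup>T *\<^sub>v col U j = s j \<cdot>\<^sub>v col V j"
proof -
  have U: "U \<in> carrier_mat m k" and V: "V \<in> carrier_mat k k"
    using svd by (auto simp: thin_svd_def)
  note C = thin_svd_carrier[OF svd]
  have *: "col (X * mat_diag k s) j = s j \<cdot>\<^sub>v col X j" if "X \<in> carrier_mat l k" for X l
    using that j by (subst mat_diag_mult_right[OF that]) (auto intro!: eq_vecI)
  show "C *\<^sub>v col V j = s j \<cdot>\<^sub>v col U j"
    using col_mult2[OF C V j] thin_svd_mult_V(1)[OF svd] *[OF U] by simp
  show "C\<^sup>T *\<^sub>v col U j = s j \<cdot>\<^sub>v col V j"
    using col_mult2[of "C\<^sup>T" k m U k j] C U j thin_svd_mult_V(2)[OF svd] *[OF V] by simp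
qed

lemma thin_svd_col_scalar_prod:
  assumes svd: "thin_svd m k C U s V" and j: "j < k"
  shows "col U j \<bullet> col U j = 1" and "V\<^sup>T *\<^sub>v col V j = unit_vec k j"
proof -
  have U: "U \<in> carrier_mat m k" "U\<^sup>T * U = 1\<^sub>m k" and V: "V \<in> carrier_mat k k" "V\<^sup>T * V = 1\<^sub>m k"
    using svd by (auto simp: thin_svd_def)
  have "(U\<^sup>T * U) $$ (j, j) = col U j \<bullet> col U j" using U(1) j by simp
  then show "col U j \<bullet> col U j = 1" using U j by simp
  have "col (V\<^sup>T * V) j = V\<^sup>T *\<^sub>v col V j" using V j by (intro col_mult2) auto
  then show "V\<^sup>T *\<^sub>v col V j = unit_vec k j" using V j by simp
qed

lemma thin_svd_norm_ge:
  assumes svd: "thin_svd m k C U s V" and p: "p \<in> carrier_vec k" and t: "\<And>i. i < k \<Longrightarrow> t \<le> s i" "0 \<le> t"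
  shows "t\<^sup>2 * (p \<bullet> p) \<le> (C *\<^sub>v p) \<bullet> (C *\<^sub>v p)"
  unfolding thin_svd_norm[OF svd p] sum_distrib_left
  using t by (intro sum_mono mult_right_mono power_mono) auto

text \<open>\<open>tls_inv\<close> applies \<open>the\<close> to the result of
  \<open>mat_inverse\<close>, so that result has to be pinned down. A one-sided inverse of a square
  matrix is two-sided, hence \<open>mat_inverse\<close> succeeds, and uniqueness of inverses
  identifies its value.\<close>

lemma mat_inverse_eq_SomeI:
  fixes P K :: "real mat"
  assumes P: "P \<in> carrier_mat n n" and K: "K \<in> carrier_mat n n" and PK: "P * K = 1\<^sub>m n"
  shows "mat_inverse P = Some K"
proof -
  have KP: "K * P = 1\<^sub>m n" using mat_mult_left_right_inverse[OF P K PK] .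
  have unit: "P \<in> Units (ring_mat TYPE(real) n ())"
    using P K PK KP by (auto simp: Units_def ring_mat_def)
  then obtain B where B: "mat_inverse P = Some B"
    using mat_inverse(1)[OF P, of "()"] by (cases "mat_inverse P") auto
  then have "P * B = 1\<^sub>m n" "B \<in> carrier_mat n n" using mat_inverse(2)[OF P B] by auto
  then have "B = (K * P) * B" using KP by simp
  also have "\<dots> = K"
    using \<open>P * B = 1\<^sub>m n\<close> \<open>B \<in> _\<close> P K by (simp add: assoc_mult_mat[of _ n n _ n _ n])
  finally show ?thesis using B by simp
qed

text \<open>The columns of V are eigenvectors of A^T A - t^2 I with eigenvalues (s i)^2 - t^2, so
  inverting the matrix amounts to inverting these numbers.\<close>

lemma tls_inv_thin_svd:
  assumes svd: "thin_svd m n A U s V" and ne: "\<And>i. i < n \<Longrightarrow> (s i)\<^sup>2 \<noteq> t\<^sup>2"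
  shows "tls_inv A t = V * mat_diag n (\<lambda>i. inverse ((s i)\<^sup>2 - t\<^sup>2)) * V\<^sup>T"
proof -
  have U: "U \<in> carrier_mat m n" and V: "V \<in> carrier_mat n n" "V\<^sup>T * V = 1\<^sub>m n"
    using svd by (auto simp: thin_svd_def)
  note A = thin_svd_carrier[OF svd]
  let ?P = "A\<^sup>T * A - t\<^sup>2 \<cdot>\<^sub>m 1\<^sub>m n" and ?D = "mat_diag n (\<lambda>i. inverse ((s i)\<^sup>2 - t\<^sup>2))"
  let ?E = "mat_diag n (\<lambda>i. (s i)\<^sup>2 - t\<^sup>2)"
  have P: "?P \<in> carrier_mat n n" using A by (intro minus_carrier_mat) auto
  have "A\<^sup>T * A * V = A\<^sup>T * (U * mat_diag n s)"
    using A V thin_svd_mult_V(1)[OF svd] by (subst assoc_mult_mat[of _ n m _ n _ n]) auto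
  also have "\<dots> = V * mat_diag n s * mat_diag n s"
    using A U thin_svd_mult_V(2)[OF svd] by (subst assoc_mult_mat[symmetric, of _ n m _ n _ n]) auto
  also have "\<dots> = V * mat_diag n (\<lambda>i. s i * s i)"
    using V by (subst assoc_mult_mat[of _ n n _ n _ n]) auto
  finally have AV: "A\<^sup>T * A * V = V * mat_diag n (\<lambda>i. s i * s i)" .
  have "?P * V = A\<^sup>T * A * V - (t\<^sup>2 \<cdot>\<^sub>m 1\<^sub>m n) * V"
    using A V by (intro minus_mult_distrib_mat[of _ n n _ _ n]) auto
  also have "(t\<^sup>2 \<cdot>\<^sub>m 1\<^sub>m n) * V = t\<^sup>2 \<cdot>\<^sub>m V" using V by (subst mult_smult_assoc_mat[of _ n n _ n]) auto
  also have "A\<^sup>T * A * V - t\<^sup>2 \<cdot>\<^sub>m V = V * ?E"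
    unfolding AV using V
    by (intro eq_matI) (auto simp: mat_diag_mult_right[OF V(1)] algebra_simps power2_eq_square)
  finally have PV: "?P * V = V * ?E" .
  have VT: "V\<^sup>T \<in> carrier_mat n n" using V by simp
  have DV: "?D * V\<^sup>T \<in> carrier_mat n n" using VT by (intro mult_carrier_mat) auto
  have "?P * (V * ?D * V\<^sup>T) = ?P * (V * (?D * V\<^sup>T))"
    by (simp add: assoc_mult_mat[OF V(1) mat_diag_dim VT])
  also have "\<dots> = V * ?E * (?D * V\<^sup>T)"
    by (simp only: assoc_mult_mat[OF P V(1) DV, symmetric] PV)
  also have "\<dots> = V * (?E * ?D * V\<^sup>T)"
    by (simp only: assoc_mult_mat[OF V(1) mat_diag_dim DV] assoc_mult_mat[OF mat_diag_dim mat_diag_dim VT])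
  \<comment> \<open>Here \<open>ne\<close> makes every diagonal entry invertible.\<close>
  also have "?E * ?D = 1\<^sub>m n"
    unfolding mat_diag_diag using ne by (intro eq_matI) (auto simp: mat_diag_def)
  also have "V * (1\<^sub>m n * V\<^sup>T) = 1\<^sub>m n" using orthogonal_mat_right[OF V] V by simp
  finally have "?P * (V * ?D * V\<^sup>T) = 1\<^sub>m n" .
  moreover have "V * ?D * V\<^sup>T \<in> carrier_mat n n" using V by (auto intro!: mult_carrier_mat)
  ultimately have "mat_inverse ?P = Some (V * ?D * V\<^sup>T)"
    using P by (intro mat_inverse_eq_SomeI)
  then show ?thesis using A by (simp add: tls_inv_def)
qed

section \<open>The TLS solution and the smallest singular vector\<close>

lemma append_cols_dim [simp]:
  "dim_row B = dim_row A \<Longrightarrow> dim_row (A @\<^sub>c B) = dim_row A"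
  "dim_col (A @\<^sub>c B) = dim_col A + dim_col B"
  by (auto simp: append_cols_def)

lemma append_cols_index [simp]:
  "i < dim_row A \<Longrightarrow> j < dim_col A + dim_col B \<Longrightarrow>
   (A @\<^sub>c B) $$ (i, j) = (if j < dim_col A then A $$ (i, j) else B $$ (i, j - dim_col A))"
  by (simp add: append_cols_def)

lemma append_cols_carrier:
  "A \<in> carrier_mat m n \<Longrightarrow> B \<in> carrier_mat m k \<Longrightarrow> A @\<^sub>c B \<in> carrier_mat m (n + k)"
  by (intro carrier_matI) auto

lemma col_mat_dim [simp]: "dim_row (col_mat v) = dim_vec v" "dim_col (col_mat v) = 1"
  by (auto simp: col_mat_def)

lemma row_mat_dim [simp]: "dim_row (row_mat v) = 1" "dim_col (row_mat v) = dim_vec v"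
  by (auto simp: row_mat_def)

lemma col_mat_index [simp]: "i < dim_vec v \<Longrightarrow> j < 1 \<Longrightarrow> col_mat v $$ (i, j) = v $ i"
  by (simp add: col_mat_def mat_of_cols_index)

lemma row_mat_index [simp]: "j < dim_vec v \<Longrightarrow> i < 1 \<Longrightarrow> row_mat v $$ (i, j) = v $ j"
  by (simp add: row_mat_def mat_of_rows_index)

text \<open>Three vectors of length n + 1 are split this way: w = (x, -1), the singular vector v =
  (z, c), and (p, 0), on which [A, b] acts like A on p.\<close>

definition vec_snoc :: "'a vec \<Rightarrow> 'a \<Rightarrow> 'a vec" where
  "vec_snoc x c = x @\<^sub>v vec 1 (\<lambda>_. c)"

lemma vec_snoc_dim [simp]: "dim_vec (vec_snoc x c) = Suc (dim_vec x)"
  by (simp add: vec_snoc_def)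

lemma vec_snoc_index [simp]:
  "i < Suc (dim_vec x) \<Longrightarrow> vec_snoc x c $ i = (if i < dim_vec x then x $ i else c)"
  by (simp add: vec_snoc_def)

lemma vec_snoc_carrier [simp]: "x \<in> carrier_vec n \<Longrightarrow> vec_snoc x c \<in> carrier_vec (Suc n)"
  by (intro carrier_vecI) simp

lemma vec_snoc_first:
  assumes "v \<in> carrier_vec (n + 1)"
  shows "vec_snoc (vec n (($) v)) (v $ n) = v"
  using assms by (intro eq_vecI) (auto simp: less_Suc_eq)

lemma scalar_prod_snoc:
  "(x :: real vec) \<in> carrier_vec n \<Longrightarrow> y \<in> carrier_vec n \<Longrightarrow> vec_snoc x c \<bullet> vec_snoc y d = x \<bullet> y + c * d"
  unfolding vec_snoc_def by (subst scalar_prod_append[of _ n _ 1]) (auto simp: scalar_prod_def)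

lemma append_col_mult_snoc:
  fixes A :: "real mat"
  assumes A: "A \<in> carrier_mat m n" and b: "b \<in> carrier_vec m" and x: "x \<in> carrier_vec n"
  shows "(A @\<^sub>c col_mat b) *\<^sub>v vec_snoc x c = A *\<^sub>v x + c \<cdot>\<^sub>v b"
proof (rule eq_vecI)
  fix i assume "i < dim_vec (A *\<^sub>v x + c \<cdot>\<^sub>v b)"
  then have i: "i < m" using b by simp
  have "row (A @\<^sub>c col_mat b) i = vec_snoc (row A i) (b $ i)"
    using A b i by (intro eq_vecI) auto
  moreover have "vec_snoc (row A i) (b $ i) \<bullet> vec_snoc x c = row A i \<bullet> x + b $ i * c"
    using A x i by (subst scalar_prod_snoc[of _ n]) auto
  ultimately show "((A @\<^sub>c col_mat b) *\<^sub>v vec_snoc x c) $ i = (A *\<^sub>v x + c \<cdot>\<^sub>v b) $ i"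
    using A b i by simp
qed (use A b in auto)

lemma frob_norm_outer:
  "frob_norm (mat m k (\<lambda>(i, j). f i * g j)) = sqrt ((\<Sum>i<m. (f i)\<^sup>2) * (\<Sum>j<k. (g j)\<^sup>2))"
  by (simp add: frob_norm_def power_mult_distrib sum_product)

text \<open>The easy half of the Eckart-Young argument: subtracting the rank-one term t u v^T from
  [A, b] gives a feasible correction of Frobenius norm t, so a minimizer cannot exceed t.\<close>

lemma tls_correction_le:
  assumes A: "A \<in> carrier_mat m n" and b: "b \<in> carrier_vec m"
    and u: "u \<in> carrier_vec m" "u \<bullet> u = 1" and z: "z \<in> carrier_vec n"
    and zc: "z \<bullet> z + c\<^sup>2 = 1" and c: "c \<noteq> 0" and t: "0 \<le> t"
    and eq: "A *\<^sub>v z + c \<cdot>\<^sub>v b = t \<cdot>\<^sub>v u"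
    and min: "tls_minimizer A b E f"
  shows "frob_norm (E @\<^sub>c col_mat f) \<le> t"
proof -
  \<comment> \<open>the correction \<open>- t u v\<^sup>T\<close> with \<open>v = (z, c)\<close>\<close>
  define E0 where "E0 = mat m n (\<lambda>(i, j). - t * u $ i * z $ j)"
  define f0 where "f0 = vec m (\<lambda>i. - t * u $ i * c)"
  have E0: "E0 \<in> carrier_mat m n" and f0: "f0 \<in> carrier_vec m" by (auto simp: E0_def f0_def)
  \<comment> \<open>The corrected matrix [A + E0, b + f0] annihilates v = (z, c). As c is nonzero,
    rescaling v to last entry -1 shows that -z/c solves the corrected system exactly.\<close>
  have "b + f0 = (A + E0) *\<^sub>v ((- 1 / c) \<cdot>\<^sub>v z)"
  proof (rule eq_vecI)
    fix i assume "i < dim_vec ((A + E0) *\<^sub>v ((- 1 / c) \<cdot>\<^sub>v z))"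
    then have i: "i < m" using E0 by simp
    have "(A *\<^sub>v z + c \<cdot>\<^sub>v b) $ i = (t \<cdot>\<^sub>v u) $ i" using eq by simp
    then have Az: "row A i \<bullet> z = t * u $ i - c * b $ i" using A b u i by simp
    have "row E0 i = (- t * u $ i) \<cdot>\<^sub>v z" using z i by (intro eq_vecI) (auto simp: E0_def)
    then have Ez: "row E0 i \<bullet> z = - t * u $ i * (1 - c\<^sup>2)"
      using z unfolding eq_diff_eq[THEN iffD2, OF zc, symmetric] by simp
    have "((A + E0) *\<^sub>v ((- 1 / c) \<cdot>\<^sub>v z)) $ i = (- 1 / c) * ((row A i + row E0 i) \<bullet> z)"
      using A E0 z i by simp
    also have "(row A i + row E0 i) \<bullet> z = row A i \<bullet> z + row E0 i \<bullet> z"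
      using A E0 z i by (intro add_scalar_prod_distrib[of _ n]) auto
    also have "(- 1 / c) * \<dots> = b $ i - t * u $ i * c"
      unfolding Az Ez using c by (simp add: field_simps power2_eq_square)
    finally show "(b + f0) $ i = ((A + E0) *\<^sub>v ((- 1 / c) \<cdot>\<^sub>v z)) $ i"
      using i by (simp add: f0_def)
  qed (use E0 f0 in auto)
  then have "tls_feasible A b E0 f0"
    using A b E0 f0 z unfolding tls_feasible_def mat_range_def by auto
  then have "frob_norm (E @\<^sub>c col_mat f) \<le> frob_norm (E0 @\<^sub>c col_mat f0)"
    using min by (auto simp: tls_minimizer_def)
  also have "E0 @\<^sub>c col_mat f0 = mat m (n + 1) (\<lambda>(i, j). (- t * u $ i) * vec_snoc z c $ j)"
    using z by (intro eq_matI) (auto simp: E0_def f0_def)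
  also have "frob_norm \<dots> = sqrt (t\<^sup>2 * (u \<bullet> u) * (vec_snoc z c \<bullet> vec_snoc z c))"
  proof -
    have "(\<Sum>i<m. (- t * u $ i)\<^sup>2) = t\<^sup>2 * (u \<bullet> u)"
      using u(1) by (simp add: scalar_prod_def atLeast0LessThan power2_eq_square sum_distrib_left mult_ac)
    moreover have "(\<Sum>j<n + 1. (vec_snoc z c $ j)\<^sup>2) = vec_snoc z c \<bullet> vec_snoc z c"
      using z unfolding scalar_prod_def by (intro sum.cong) (auto simp: power2_eq_square)
    ultimately show ?thesis by (simp only: frob_norm_outer)
  qed
  also have "\<dots> = t"
    using u z zc t by (simp add: scalar_prod_snoc[of _ n] power2_eq_square)
  finally show ?thesis .
qed

text \<open>\<open>gap\<close> is used twice: it keeps the last entry of v away from 0, and it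
  excludes a second direction in the bottom singular space, since two directions could be combined
  into a nonzero vector (p0, 0) on which [A, b] acts as A.\<close>

lemma tls_solution_singular_vector:
  assumes A: "A \<in> carrier_mat m n" and b: "b \<in> carrier_vec m"
    and svd: "thin_svd m (n + 1) (A @\<^sub>c col_mat b) U s V"
    and gap: "\<And>z. z \<in> carrier_vec n \<Longrightarrow> z \<noteq> 0\<^sub>v n \<Longrightarrow> (s n)\<^sup>2 * (z \<bullet> z) < (A *\<^sub>v z) \<bullet> (A *\<^sub>v z)"
    and sol: "tls_solution A b x"
  obtains \<alpha> where "col V n = \<alpha> \<cdot>\<^sub>v vec_snoc x (- 1)" "\<alpha>\<^sup>2 * (x \<bullet> x + 1) = 1"
proof -
  let ?C = "A @\<^sub>c col_mat b" and ?t = "s n" and ?u = "col U n" and ?w = "vec_snoc x (- 1)"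
  define v where "v = col V n"
  have U: "U \<in> carrier_mat m (n + 1)" and V: "V \<in> carrier_mat (n + 1) (n + 1)" "V\<^sup>T * V = 1\<^sub>m (n + 1)"
    and s0: "0 \<le> ?t" and mono: "\<And>i. i \<le> n \<Longrightarrow> ?t \<le> s i"
    using svd by (auto simp: thin_svd_def)
  have C: "?C \<in> carrier_mat m (n + 1)" using thin_svd_carrier[OF svd] .
  have v: "v \<in> carrier_vec (n + 1)" and u: "?u \<in> carrier_vec m" 
    using carrier_matD(1)[OF U] carrier_matD(1)[OF V(1)] by (auto simp: v_def intro!: carrier_vecI)
  have x: "x \<in> carrier_vec n" using sol A by (simp add: tls_solution_def)
  then have w: "?w \<in> carrier_vec (n + 1)" by simp
  define z c where "z = vec n (($) v)" and "c = v $ n"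
  have z: "z \<in> carrier_vec n" by (simp add: z_def)
  have v_eq: "v = vec_snoc z c" using vec_snoc_first[OF v] by (simp add: z_def c_def)
  have uu: "?u \<bullet> ?u = 1" and Vv: "V\<^sup>T *\<^sub>v v = unit_vec (n + 1) n"
    using thin_svd_col_scalar_prod[OF svd, of n] by (auto simp: v_def)
  have "col V n \<bullet> col V n = (V\<^sup>T * V) $$ (n, n)" using V(1) by simp
  then have vv: "v \<bullet> v = 1" using V by (simp add: v_def)
  then have zc: "z \<bullet> z + c\<^sup>2 = 1"
    using z by (simp add: v_eq scalar_prod_snoc[of _ n] power2_eq_square)
  have Cv: "A *\<^sub>v z + c \<cdot>\<^sub>v b = ?t \<cdot>\<^sub>v ?u"
    using thin_svd_singular_vectors(1)[OF svd, of n] append_col_mult_snoc[OF A b z, of c]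
    by (simp add: v_eq[symmetric] v_def)
  \<comment> \<open>If c were 0, then z would be a unit vector with |A z| = \<open>s n\<close>,
    against \<open>gap\<close>.\<close>
  have c0: "c \<noteq> 0"
  proof
    assume "c = 0"
    then have "c \<cdot>\<^sub>v b = 0\<^sub>v m" using b by (intro eq_vecI) auto
    then have "A *\<^sub>v z = ?t \<cdot>\<^sub>v ?u" using Cv A z mult_mat_vec_carrier[OF A z] by simp
    then have "(A *\<^sub>v z) \<bullet> (A *\<^sub>v z) = ?t\<^sup>2" using u uu by (simp add: power2_eq_square)
    moreover have "z \<bullet> z = 1" using zc \<open>c = 0\<close> by simp
    moreover have "z \<noteq> 0\<^sub>v n" using \<open>z \<bullet> z = 1\<close> by auto
    ultimately show False using gap[OF z] by simp
  qed
  obtain E f where min: "tls_minimizer A b E f" and Ex: "(A + E) *\<^sub>v x = b + f"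
    using sol by (auto simp: tls_solution_def)
  have E: "E \<in> carrier_mat m n" and f: "f \<in> carrier_vec m"
    using min A by (auto simp: tls_minimizer_def tls_feasible_def)
  \<comment> \<open>The equation (A + E) x = b + f says that [A + E, b + f] annihilates w = (x, -1),
    so [A, b] w and [E, f] w have the same length.\<close>
  have "A *\<^sub>v x + (- 1) \<cdot>\<^sub>v b = - (E *\<^sub>v x + (- 1) \<cdot>\<^sub>v f)"
  proof (rule eq_vecI)
    fix i assume "i < dim_vec (- (E *\<^sub>v x + (- 1) \<cdot>\<^sub>v f))"
    then have i: "i < m" using f by simp
    have "((A + E) *\<^sub>v x) $ i = (b + f) $ i" using Ex by simp
    moreover have "(A + E) *\<^sub>v x = A *\<^sub>v x + E *\<^sub>v x" using A E x by (intro add_mult_distrib_mat_vec) auto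
    ultimately show "(A *\<^sub>v x + (- 1) \<cdot>\<^sub>v b) $ i = (- (E *\<^sub>v x + (- 1) \<cdot>\<^sub>v f)) $ i"
      using A E b f i by simp
  qed (use A b E f in auto)
  then have "?C *\<^sub>v ?w = - ((E @\<^sub>c col_mat f) *\<^sub>v ?w)"
    using append_col_mult_snoc[OF A b x, of "- 1"] append_col_mult_snoc[OF E f x, of "- 1"] by simp
  then have "norm2_vec (?C *\<^sub>v ?w) = norm2_vec ((E @\<^sub>c col_mat f) *\<^sub>v ?w)"
    by (simp add: norm2_vec_def)
  also have "\<dots> \<le> frob_norm (E @\<^sub>c col_mat f) * norm2_vec ?w"
    using E x by (intro norm2_mult_le_frob) auto
  also have "\<dots> \<le> ?t * norm2_vec ?w"
    using tls_correction_le[OF A b u uu z zc c0 s0 Cv min] by (intro mult_right_mono) auto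
  finally have "(norm2_vec (?C *\<^sub>v ?w))\<^sup>2 \<le> (?t * norm2_vec ?w)\<^sup>2"
    by (intro power_mono) auto
  then have le: "(?C *\<^sub>v ?w) \<bullet> (?C *\<^sub>v ?w) \<le> ?t\<^sup>2 * (?w \<bullet> ?w)"
    by (simp only: norm2_vec_sq power_mult_distrib)
  define a where "a = V\<^sup>T *\<^sub>v ?w"
  \<comment> \<open>\<open>s n\<close> is the least singular value, so a sum that is at most 0 has
    nonnegative terms and each of them vanishes: w has no component along directions with
    \<open>s i\<close> greater than \<open>s n\<close>.\<close>
  have term_nonneg: "0 \<le> ((s i)\<^sup>2 - ?t\<^sup>2) * (a $ i)\<^sup>2" if "i \<in> {..<n + 1}" for i
    using that mono[of i] s0 by (intro mult_nonneg_nonneg) (auto intro: power_mono)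
  have "(\<Sum>i<n + 1. ((s i)\<^sup>2 - ?t\<^sup>2) * (a $ i)\<^sup>2) \<le> 0"
    using le unfolding thin_svd_norm[OF svd w] sum_distrib_left a_def
    by (simp only: left_diff_distrib sum_subtractf)
  then have "(\<Sum>i<n + 1. ((s i)\<^sup>2 - ?t\<^sup>2) * (a $ i)\<^sup>2) = 0"
    by (intro antisym sum_nonneg term_nonneg) auto
  then have zero: "((s i)\<^sup>2 - ?t\<^sup>2) * (a $ i)\<^sup>2 = 0" if "i < n + 1" for i
    using that term_nonneg by (subst (asm) sum_nonneg_eq_0_iff) auto
  \<comment> \<open>combining \<open>(x, -1)\<close> with \<open>v\<close> so that the last component vanishes\<close>
  define p where "p = ?w + (1 / c) \<cdot>\<^sub>v v"
  have p: "p \<in> carrier_vec (n + 1)" using w v by (simp add: p_def)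
  define p0 where "p0 = x + (1 / c) \<cdot>\<^sub>v z"
  have p0: "p0 \<in> carrier_vec n" using x z by (simp add: p0_def)
  have p_eq: "p = vec_snoc p0 0"
    using x z c0 by (intro eq_vecI) (auto simp: p_def p0_def v_eq)
  have Vp: "V\<^sup>T *\<^sub>v p = a + (1 / c) \<cdot>\<^sub>v unit_vec (n + 1) n"
    using V w v Vv unfolding p_def a_def
    by (simp add: mult_add_distrib_mat_vec[of _ "n + 1" "n + 1"] mult_mat_vec[of _ "n + 1" "n + 1"])
  \<comment> \<open>Adding a multiple of v changes only coordinate n, where the factor is zero, so p
    stays in the bottom singular space.\<close>
  have "((s i)\<^sup>2 - ?t\<^sup>2) * ((V\<^sup>T *\<^sub>v p) $ i)\<^sup>2 = 0" if "i < n + 1" for i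
    using zero[OF that] that V(1) unfolding Vp by (cases "i = n") (auto simp: a_def unit_vec_def)
  then have "(?C *\<^sub>v p) \<bullet> (?C *\<^sub>v p) = ?t\<^sup>2 * (p \<bullet> p)"
    unfolding thin_svd_norm[OF svd p] sum_distrib_left
    by (intro sum.cong) (auto simp: left_diff_distrib)
  moreover have "?C *\<^sub>v p = A *\<^sub>v p0"
    unfolding p_eq using A b p0 by (subst append_col_mult_snoc[of _ m n]) auto
  moreover have "p \<bullet> p = p0 \<bullet> p0"
    unfolding p_eq using p0 by (simp add: scalar_prod_snoc[of _ n])
  \<comment> \<open>The equality |A p0|^2 = (s n)^2 |p0|^2 contradicts the strict \<open>gap\<close>
    unless p0 is zero.\<close>
  ultimately have "p0 = 0\<^sub>v n" using gap[OF p0] by fastforce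
  have v_w: "v = (- c) \<cdot>\<^sub>v ?w"
  proof (rule eq_vecI)
    fix i assume "i < dim_vec ((- c) \<cdot>\<^sub>v ?w)"
    then have i: "i < n + 1" using x by simp
    have "p $ i = 0" using i unfolding p_eq \<open>p0 = 0\<^sub>v n\<close> by auto
    then have "?w $ i + (1 / c) * v $ i = 0" using i v x by (simp add: p_def)
    then show "v $ i = ((- c) \<cdot>\<^sub>v ?w) $ i" using c0 i x by (simp add: field_simps)
  qed (use v x in auto)
  have "v \<bullet> v = c\<^sup>2 * (?w \<bullet> ?w)"
    using w unfolding v_w by (simp add: power2_eq_square)
  then have "(- c)\<^sup>2 * (x \<bullet> x + 1) = 1" using vv x by (simp add: scalar_prod_snoc[of _ n])
  then show thesis using that v_w by (simp add: v_def)
qed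

section \<open>The condition numbers\<close>

text \<open>A Kronecker column index runs through k consecutive blocks of length m; division and
  remainder by m recover the block and the position inside it.\<close>

lemma sum_div_mod:
  fixes f :: "nat \<Rightarrow> nat \<Rightarrow> 'a :: comm_monoid_add"
  shows "(\<Sum>j<k * m. f (j div m) (j mod m)) = (\<Sum>a<k. \<Sum>q<m. f a q)"
proof -
  have "(\<Sum>j\<in>{a * m..<a * m + m}. f (j div m) (j mod m)) = (\<Sum>q<m. f a q)" for a
  proof -
    have "(\<Sum>j\<in>{a * m..<a * m + m}. f (j div m) (j mod m))
      = (\<Sum>q\<in>{0..<m}. f ((q + a * m) div m) ((q + a * m) mod m))"
      using sum.shift_bounds_nat_ivl[of "\<lambda>j. f (j div m) (j mod m)" 0 "a * m" m]
      by (simp add: add.commute)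
    also have "\<dots> = (\<Sum>q<m. f a q)" by (intro sum.cong) auto
    finally show ?thesis .
  qed
  then show ?thesis by (simp add: sum.nat_group[of _ m k, symmetric])
qed

text \<open>The left side is the squared Frobenius norm of a difference of two rank-one matrices;
  after expansion each product separates into a sum over a and a sum over q.\<close>

lemma sum_rank_two_sq:
  fixes P r w g :: "nat \<Rightarrow> real"
  shows "(\<Sum>a<k. \<Sum>q<m. (P a * r q - w a * g q)\<^sup>2)
    = (\<Sum>a<k. P a * P a) * (\<Sum>q<m. r q * r q) - 2 * (\<Sum>a<k. w a * P a) * (\<Sum>q<m. g q * r q)
      + (\<Sum>a<k. w a * w a) * (\<Sum>q<m. g q * g q)"
proof -
  have "(\<Sum>a<k. \<Sum>q<m. (P a * r q - w a * g q)\<^sup>2)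
    = (\<Sum>a<k. \<Sum>q<m. (P a * P a) * (r q * r q)) - (\<Sum>a<k. \<Sum>q<m. (2 * (w a * P a)) * (g q * r q))
      + (\<Sum>a<k. \<Sum>q<m. (w a * w a) * (g q * g q))"
    unfolding sum.distrib[symmetric] sum_subtractf[symmetric]
    by (intro sum.cong refl) (simp add: power2_eq_square algebra_simps)
  then show ?thesis by (simp only: sum_distrib_left[of 2] sum_product)
qed

text \<open>Up to the factor \<open>(A\<^sup>T A - \<sigma>\<^sup>2 I)\<^sup>-\<^sup>1\<close>, this is the matrix inside the norms of both
  \<open>K_ZLWQ\<close> and \<open>K_LJ\<close>; the column index \<open>j\<close> encodes the entry \<open>(j mod m, j div m)\<close> of a perturbation
  of \<open>[A, b]\<close>, and \<open>\<beta> = 1 / (1 + \<parallel>x\<parallel>\<^sup>2)\<close>.\<close>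

definition tls_deriv :: "nat \<Rightarrow> nat \<Rightarrow> real mat \<Rightarrow> real vec \<Rightarrow> real vec \<Rightarrow> real \<Rightarrow> real mat" where
  "tls_deriv m n A x r \<beta> = mat n ((n + 1) * m) (\<lambda>(i, j).
     vec_snoc x (- 1) $ (j div m) * (- 2 * \<beta> * x $ i * r $ (j mod m) - A $$ (j mod m, i))
       + (if j div m = i then r $ (j mod m) else 0))"

lemma tls_deriv_carrier: "tls_deriv m n A x r \<beta> \<in> carrier_mat n ((n + 1) * m)"
  by (simp only: tls_deriv_def mat_carrier)

text \<open>Arranged as an m by (n + 1) array, Q^T p is r p'^T - g w^T with p' = (p, 0) and w = (x,
  -1), so \<open>sum_rank_two_sq\<close> reduces its norm to a few inner products.\<close>

lemma tls_deriv_transpose_norm: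
  assumes A: "A \<in> carrier_mat m n" and x: "x \<in> carrier_vec n" and r: "r \<in> carrier_vec m"
    and p: "p \<in> carrier_vec n"
    and Ar: "A\<^sup>T *\<^sub>v r = (- t\<^sup>2) \<cdot>\<^sub>v x" and rr: "\<beta> * (r \<bullet> r) = t\<^sup>2"
    and xx: "\<beta> * (x \<bullet> x + 1) = 1"
  defines "Q \<equiv> tls_deriv m n A x r \<beta>"
  shows "(Q\<^sup>T *\<^sub>v p) \<bullet> (Q\<^sup>T *\<^sub>v p)
    = (x \<bullet> x + 1) * ((A *\<^sub>v p) \<bullet> (A *\<^sub>v p)) - 2 * t\<^sup>2 * (x \<bullet> p)\<^sup>2 + (p \<bullet> p) * (r \<bullet> r)"
proof -
  let ?w = "vec_snoc x (- 1)" and ?p = "vec_snoc p 0"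
  \<comment> \<open>For nonzero r, \<open>Ar\<close> and \<open>rr\<close> make g the Householder
    reflection of A p in the hyperplane orthogonal to r. This explains \<open>gr\<close> and
    \<open>gg\<close>: the component along r changes sign and the length is kept.\<close>
  define g where "g = A *\<^sub>v p + (2 * \<beta> * (x \<bullet> p)) \<cdot>\<^sub>v r"
  have Q: "Q \<in> carrier_mat n ((n + 1) * m)" unfolding Q_def by (rule tls_deriv_carrier)
  have g: "g \<in> carrier_vec m" and Ap: "A *\<^sub>v p \<in> carrier_vec m" using A p r by (auto simp: g_def)
  have entry: "(Q\<^sup>T *\<^sub>v p) $ j = ?p $ (j div m) * r $ (j mod m) - ?w $ (j div m) * g $ (j mod m)"
    if j: "j < (n + 1) * m" for j
  proof -
    let ?a = "j div m" and ?q = "j mod m"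
    have m: "m > 0" using j by (cases m) auto
    have a: "?a < n + 1" using j by (rule less_mult_imp_div_less)
    have q: "?q < m" using m by simp
    have "(Q\<^sup>T *\<^sub>v p) $ j = (\<Sum>i\<in>{0..<n}. Q $$ (i, j) * p $ i)"
      using Q p j by (simp add: scalar_prod_def)
    also have "\<dots> = (\<Sum>i\<in>{0..<n}. (- 2 * \<beta> * ?w $ ?a * r $ ?q) * (x $ i * p $ i)
        - ?w $ ?a * (A $$ (?q, i) * p $ i) + (if ?a = i then r $ ?q * p $ i else 0))"
      using j by (intro sum.cong) (auto simp: Q_def tls_deriv_def algebra_simps)
    also have "\<dots> = (- 2 * \<beta> * ?w $ ?a * r $ ?q) * (x \<bullet> p) - ?w $ ?a * (row A ?q \<bullet> p)
        + (if ?a < n then r $ ?q * p $ ?a else 0)"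
      unfolding sum.distrib sum_subtractf sum_distrib_left[symmetric] using A p q
      by (simp add: scalar_prod_def)
    \<comment> \<open>The last block, ?a = n, has no Kronecker contribution, which the appended 0 in
      ?p encodes.\<close>
    also have "(if ?a < n then r $ ?q * p $ ?a else 0) = ?p $ ?a * r $ ?q"
      using a p by simp
    also have "(- 2 * \<beta> * ?w $ ?a * r $ ?q) * (x \<bullet> p) - ?w $ ?a * (row A ?q \<bullet> p) = - ?w $ ?a * g $ ?q"
      using q A r by (simp add: g_def algebra_simps del: vec_snoc_index)
    finally show ?thesis by simp
  qed
  have "(Q\<^sup>T *\<^sub>v p) \<bullet> (Q\<^sup>T *\<^sub>v p) = (\<Sum>j<(n + 1) * m. ((Q\<^sup>T *\<^sub>v p) $ j)\<^sup>2)"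
    using Q unfolding scalar_prod_def[of "Q\<^sup>T *\<^sub>v p"]
    by (intro sum.cong) (auto simp: power2_eq_square)
  also have "\<dots> = (\<Sum>j<(n + 1) * m. (?p $ (j div m) * r $ (j mod m) - ?w $ (j div m) * g $ (j mod m))\<^sup>2)"
    by (intro sum.cong) (auto simp only: entry lessThan_iff)
  also have "\<dots> = (\<Sum>a<n + 1. \<Sum>q<m. (?p $ a * r $ q - ?w $ a * g $ q)\<^sup>2)"
    by (rule sum_div_mod)
  also have "\<dots> = (?p \<bullet> ?p) * (r \<bullet> r) - 2 * (?w \<bullet> ?p) * (g \<bullet> r) + (?w \<bullet> ?w) * (g \<bullet> g)"
  proof -
    have [simp]: "dim_vec ?p = n + 1" "dim_vec ?w = n + 1" "dim_vec r = m" "dim_vec g = m"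
      using p x r g by auto
    show ?thesis
      unfolding sum_rank_two_sq scalar_prod_def[of _ r] scalar_prod_def[of _ g] scalar_prod_def[of _ ?p]
        scalar_prod_def[of _ ?w] by (simp only: \<open>dim_vec ?p = _\<close> \<open>dim_vec ?w = _\<close> \<open>dim_vec r = _\<close>
        \<open>dim_vec g = _\<close> atLeast0LessThan)
  qed
  also have "\<dots> = (p \<bullet> p) * (r \<bullet> r) - 2 * (x \<bullet> p) * (g \<bullet> r) + (x \<bullet> x + 1) * (g \<bullet> g)"
    using x p by (simp add: scalar_prod_snoc[of _ n])
  finally have 1: "(Q\<^sup>T *\<^sub>v p) \<bullet> (Q\<^sup>T *\<^sub>v p)
    = (p \<bullet> p) * (r \<bullet> r) - 2 * (x \<bullet> p) * (g \<bullet> r) + (x \<bullet> x + 1) * (g \<bullet> g)" .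
  have rAp: "r \<bullet> (A *\<^sub>v p) = - t\<^sup>2 * (x \<bullet> p)"
    using transpose_vec_mult_scalar[OF A p r] x p unfolding Ar by simp
  then have Apr: "(A *\<^sub>v p) \<bullet> r = - t\<^sup>2 * (x \<bullet> p)"
    using comm_scalar_prod[OF r Ap] by simp
  let ?c = "2 * \<beta> * (x \<bullet> p)"
  have gr: "g \<bullet> r = t\<^sup>2 * (x \<bullet> p)"
  proof -
    have "g \<bullet> r = (A *\<^sub>v p) \<bullet> r + ?c * (r \<bullet> r)"
      using Ap r by (simp add: g_def add_scalar_prod_distrib[of _ m])
    also have "\<dots> = - t\<^sup>2 * (x \<bullet> p) + 2 * (x \<bullet> p) * (\<beta> * (r \<bullet> r))" by (simp add: Apr)
    finally show ?thesis unfolding rr by (simp add: algebra_simps)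
  qed
  have gg: "g \<bullet> g = (A *\<^sub>v p) \<bullet> (A *\<^sub>v p)"
  proof -
    have "g \<bullet> g = (A *\<^sub>v p) \<bullet> g + ?c * (r \<bullet> g)"
      using Ap r g unfolding g_def
      by (subst add_scalar_prod_distrib[of _ m]) auto
    also have "r \<bullet> g = t\<^sup>2 * (x \<bullet> p)" using gr comm_scalar_prod[OF r g] by simp
    also have "(A *\<^sub>v p) \<bullet> g = (A *\<^sub>v p) \<bullet> (A *\<^sub>v p) + ?c * ((A *\<^sub>v p) \<bullet> r)"
      using Ap r unfolding g_def by (subst scalar_prod_add_distrib[of _ m]) auto
    finally show ?thesis unfolding Apr by simp
  qed
  show ?thesis unfolding 1 gr gg by (simp add: power2_eq_square algebra_simps)
qed

section \<open>Entrywise identification of the matrices in \<open>K_LJ\<close> and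
  \<open>K_ZLWQ\<close>\<close>

lemma kron_dim [simp]:
  "dim_row (kron A B) = dim_row A * dim_row B" "dim_col (kron A B) = dim_col A * dim_col B"
  by (simp_all add: kron_def)

lemma G_LJ_dim [simp]: "dim_row (G_LJ m x) = m" "dim_col (G_LJ m x) = (dim_vec x + 1) * m"
  by (auto simp: G_LJ_def)

text \<open>G is w^T kron I_m with w = (x, -1), so its column j has at most one nonzero entry,
  namely entry j div m of w in row j mod m.\<close>

lemma mult_G_LJ_index:
  assumes X: "X \<in> carrier_mat l m" and x: "x \<in> carrier_vec n" and i: "i < l" and j: "j < (n + 1) * m"
  shows "(X * G_LJ m x) $$ (i, j) = X $$ (i, j mod m) * vec_snoc x (- 1) $ (j div m)"
proof -
  have m: "m > 0" using j by (cases m) auto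
  have a: "j div m < n + 1" using j by (rule less_mult_imp_div_less)
  have G: "G_LJ m x $$ (k, j) = (if j mod m = k then vec_snoc x (- 1) $ (j div m) else 0)" if "k < m" for k
    using that m x j a by (auto simp: G_LJ_def kron_def)
  have "(X * G_LJ m x) $$ (i, j) = (\<Sum>k\<in>{0..<m}. X $$ (i, k) * G_LJ m x $$ (k, j))"
    using X x i j by (simp add: scalar_prod_def)
  also have "\<dots> = (\<Sum>k\<in>{0..<m}. if j mod m = k then X $$ (i, k) * vec_snoc x (- 1) $ (j div m) else 0)"
    by (intro sum.cong) (auto simp: G)
  also have "\<dots> = X $$ (i, j mod m) * vec_snoc x (- 1) $ (j div m)" using m by simp
  finally show ?thesis .
qed

text \<open>Separates the columns that perturb A from those that perturb b, matching the split at n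
  * m made by \<open>append_cols\<close> with the split by j div m in
  \<open>tls_deriv\<close>.\<close>

lemma less_Suc_mult_cases:
  fixes j m n :: nat
  assumes "j < (n + 1) * m"
  obtains "j < n * m" "j div m < n" | "\<not> j < n * m" "j div m = n" "j mod m = j - n * m"
proof (cases "j < n * m")
  case True
  then show thesis using that(1) less_mult_imp_div_less by blast
next
  case False
  moreover from assms have "j div m < n + 1" by (rule less_mult_imp_div_less)
  moreover have "n \<le> j div m"
    using False assms by (metis div_le_mono div_mult_self_is_m gr0I mult_0_right not_less less_nat_zero_code)
  ultimately have "j div m = n" by simp
  then show thesis using that(2) False by (metis minus_div_mult_eq_mod)
qed

text \<open>The identities A^T r = -t^2 x and t^2 / |r|^2 = \<open>\<beta>\<close> turn A^T e e^T
  into the rank-one matrix with entries -\<open>\<beta>\<close> x_i r_q; normalizing r requires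
  \<open>r0\<close>.\<close>

lemma LJ_matrix_eq:
  assumes A: "A \<in> carrier_mat m n" and x: "x \<in> carrier_vec n" and r: "r \<in> carrier_vec m"
    and r0: "r \<noteq> 0\<^sub>v m"
    and Ar: "A\<^sup>T *\<^sub>v r = (- t\<^sup>2) \<cdot>\<^sub>v x" and rr: "\<beta> * (r \<bullet> r) = t\<^sup>2"
  defines "e \<equiv> inverse (norm2_vec r) \<cdot>\<^sub>v r"
  shows "2 \<cdot>\<^sub>m (A\<^sup>T * col_mat e * row_mat e * G_LJ m x) - A\<^sup>T * G_LJ m x
           + (kron (1\<^sub>m n) (row_mat r) @\<^sub>c 0\<^sub>m n m) = tls_deriv m n A x r \<beta>"
    (is "?L = ?R")
proof (rule eq_matI)
  fix i j assume "i < dim_row ?R" "j < dim_col ?R"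
  then have i: "i < n" and j: "j < (n + 1) * m" by (auto simp: tls_deriv_def)
  have m: "m > 0" using j by (cases m) auto
  let ?a = "j div m" and ?q = "j mod m" and ?w = "vec_snoc x (- 1)"
  have q: "?q < m" using m by simp
  have e: "e \<in> carrier_vec m" using r by (simp add: e_def)
  have X: "A\<^sup>T * col_mat e * row_mat e \<in> carrier_mat n m"
    using A e by (intro carrier_matI) auto
  have rpos: "r \<bullet> r \<noteq> 0" using r r0 scalar_prod_self_eq_0 by blast
  have col: "col (col_mat e) 0 = e" and row: "row (row_mat e) 0 = e"
    by (auto intro!: eq_vecI simp: col_def row_def)
  have Ae: "A\<^sup>T *\<^sub>v e = (inverse (norm2_vec r) * (- t\<^sup>2)) \<cdot>\<^sub>v x"
    using A r unfolding e_def
    by (subst mult_mat_vec[of _ n m]) (auto simp: Ar smult_smult_assoc)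
  have "(A\<^sup>T * col_mat e * row_mat e) $$ (i, ?q) = (A\<^sup>T *\<^sub>v e) $ i * e $ ?q"
    using A e i q by (simp add: scalar_prod_def[of "row (A\<^sup>T * col_mat e) i"] col)
  also have "\<dots> = - (t\<^sup>2 * inverse ((norm2_vec r)\<^sup>2)) * x $ i * r $ ?q"
    unfolding Ae using x r i q by (simp add: e_def power2_eq_square)
  also have "t\<^sup>2 * inverse ((norm2_vec r)\<^sup>2) = \<beta>"
    using rpos by (simp add: norm2_vec_sq rr[symmetric])
  finally have ee: "(A\<^sup>T * col_mat e * row_mat e) $$ (i, ?q) = - \<beta> * x $ i * r $ ?q" by simp
  have kr: "(kron (1\<^sub>m n) (row_mat r) @\<^sub>c 0\<^sub>m n m) $$ (i, j) = (if ?a = i then r $ ?q else 0)"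
    using j by (rule less_Suc_mult_cases) (use i j r q in \<open>auto simp: kron_def append_cols_def\<close>)
  have "?L $$ (i, j) = 2 * ((A\<^sup>T * col_mat e * row_mat e * G_LJ m x) $$ (i, j)) - (A\<^sup>T * G_LJ m x) $$ (i, j)
      + (kron (1\<^sub>m n) (row_mat r) @\<^sub>c 0\<^sub>m n m) $$ (i, j)"
    using A x r i j by (simp add: kron_def del: append_cols_index index_mult_mat(1))
  also have "\<dots> = ?R $$ (i, j)"
    unfolding mult_G_LJ_index[OF X x i j] ee kr using A i j q
    by (simp add: mult_G_LJ_index[OF _ x i j, of "A\<^sup>T"] tls_deriv_def algebra_simps del: vec_snoc_index)
  finally show "?L $$ (i, j) = ?R $$ (i, j)" .
next
  show "dim_row ?L = dim_row ?R" using A x r by (simp add: tls_deriv_def kron_def)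
next
  show "dim_col ?L = dim_col ?R" using A x r by (simp add: tls_deriv_def kron_def)
qed

text \<open>In M the two terms K kron b^T and K kron (A x)^T merge into K kron r^T. In N,
  substituting v = \<open>\<alpha>\<close> w and t u = -\<open>\<alpha>\<close> r produces the
  rank-one term of \<open>tls_deriv\<close> multiplied by K.\<close>

lemma ZLWQ_matrix_eq:
  assumes A: "A \<in> carrier_mat m n" and b: "b \<in> carrier_vec m" and x: "x \<in> carrier_vec n"
    and r: "r = b - A *\<^sub>v x" and K: "tls_inv A t \<in> carrier_mat n n"
    and v: "v = \<alpha> \<cdot>\<^sub>v vec_snoc x (- 1)" and u: "u \<in> carrier_vec m" "t \<cdot>\<^sub>v u = (- \<alpha>) \<cdot>\<^sub>v r"
  shows "M_ZLWQ A b x t + N_ZLWQ A x t u v = tls_inv A t * tls_deriv m n A x r (\<alpha>\<^sup>2)"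
    (is "?L = ?R")
proof (rule eq_matI)
  define K where "K = tls_inv A t"
  have K: "K \<in> carrier_mat n n" using K by (simp add: K_def)
  define KA where "KA = K * A\<^sup>T"
  have KA: "KA \<in> carrier_mat n m" using K A by (simp add: KA_def)
  have r_carrier: "r \<in> carrier_vec m" using A b x by (simp add: r)
  define y where "y = K *\<^sub>v x"
  have y: "y \<in> carrier_vec n" using K x by (simp add: y_def)
  have v_dim: "dim_vec v = n + 1" using x by (simp add: v)
  let ?Q = "tls_deriv m n A x r (\<alpha>\<^sup>2)"
  fix i j assume "i < dim_row ?R" "j < dim_col ?R"
  then have i: "i < n" and j: "j < (n + 1) * m" using K by (auto simp: tls_deriv_def K_def)
  let ?a = "j div m" and ?q = "j mod m" and ?w = "vec_snoc x (- 1)"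
  have m: "m > 0" using j by (cases m) auto
  have q: "?q < m" using m by simp
  have a: "?a < n + 1" using j by (rule less_mult_imp_div_less)
  have KA_index: "KA $$ (i, ?q) = (\<Sum>l\<in>{0..<n}. K $$ (i, l) * A $$ (?q, l))"
    using K A i q by (simp add: KA_def scalar_prod_def)
  have y_index: "y $ i = (\<Sum>l\<in>{0..<n}. K $$ (i, l) * x $ l)"
    using K x i by (simp add: y_def scalar_prod_def)
  have "?R $$ (i, j) = (\<Sum>l\<in>{0..<n}. K $$ (i, l) * ?Q $$ (l, j))"
    using K i j by (simp add: K_def[symmetric] scalar_prod_def carrier_matD[OF tls_deriv_carrier])
  also have "\<dots> = (\<Sum>l\<in>{0..<n}. (- 2 * \<alpha>\<^sup>2 * ?w $ ?a * r $ ?q) * (K $$ (i, l) * x $ l)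
      - ?w $ ?a * (K $$ (i, l) * A $$ (?q, l)) + (if ?a = l then K $$ (i, l) * r $ ?q else 0))"
    using j by (intro sum.cong) (auto simp: tls_deriv_def algebra_simps simp del: vec_snoc_index)
  also have "\<dots> = (- 2 * \<alpha>\<^sup>2 * ?w $ ?a * r $ ?q) * y $ i - ?w $ ?a * KA $$ (i, ?q)
      + (if ?a < n then K $$ (i, ?a) * r $ ?q else 0)"
    unfolding sum.distrib sum_subtractf sum_distrib_left[symmetric] KA_index y_index by simp
  finally have R: "?R $$ (i, j) = (- 2 * \<alpha>\<^sup>2 * ?w $ ?a * r $ ?q) * y $ i - ?w $ ?a * KA $$ (i, ?q)
      + (if ?a < n then K $$ (i, ?a) * r $ ?q else 0)" .
  have rq: "r $ ?q = b $ ?q - (A *\<^sub>v x) $ ?q" using A b q by (simp add: r)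
  have M: "M_ZLWQ A b x t $$ (i, j) = - ?w $ ?a * KA $$ (i, ?q)
      + (if ?a < n then K $$ (i, ?a) * r $ ?q else 0)"
    using j
  proof (rule less_Suc_mult_cases)
    assume jn: "j < n * m" and an: "?a < n"
    have "M_ZLWQ A b x t $$ (i, j)
      = K $$ (i, ?a) * b $ ?q - x $ ?a * KA $$ (i, ?q) - K $$ (i, ?a) * (A *\<^sub>v x) $ ?q"
      using K KA A b x i jn an q
      by (simp add: M_ZLWQ_def Let_def K_def[symmetric] KA_def[symmetric] kron_def del: index_mult_mat_vec)
    then show ?thesis using an x by (simp add: rq algebra_simps del: index_mult_mat_vec)
  next
    assume "\<not> j < n * m" "?a = n" "?q = j - n * m"
    then show ?thesis
      using K KA A b x i j
      by (simp add: M_ZLWQ_def Let_def K_def[symmetric] KA_def[symmetric])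
  qed
  have "N_ZLWQ A x t u v $$ (i, j) = 2 * t * (y $ i * (v $ ?a * u $ ?q))"
    using y u v_dim i j q a
    by (simp add: N_ZLWQ_def Let_def K_def[symmetric] y_def[symmetric] scalar_prod_def kron_def)
  \<comment> \<open>Absorbing t into u makes the relation for t u applicable without a division by
    t.\<close>
  also have "\<dots> = 2 * (y $ i * (v $ ?a * (t \<cdot>\<^sub>v u) $ ?q))" using u(1) q by simp
  also have "\<dots> = (- 2 * \<alpha>\<^sup>2 * ?w $ ?a * r $ ?q) * y $ i"
    unfolding u(2) v using r_carrier x q a by (simp add: power2_eq_square del: vec_snoc_index)
  finally have N: "N_ZLWQ A x t u v $$ (i, j) = (- 2 * \<alpha>\<^sup>2 * ?w $ ?a * r $ ?q) * y $ i" .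
  have "dim_row (N_ZLWQ A x t u v) = n" "dim_col (N_ZLWQ A x t u v) = (n + 1) * m"
    using K x u v_dim by (simp_all add: N_ZLWQ_def Let_def K_def[symmetric])
  then show "?L $$ (i, j) = ?R $$ (i, j)"
    using i j M N R by simp
next
  show "dim_row ?L = dim_row ?R" "dim_col ?L = dim_col ?R"
    using K x u by (simp_all add: N_ZLWQ_def Let_def v carrier_matD[OF tls_deriv_carrier])
qed

section \<open>The transposed matrix of \<open>K_BG\<close> applied to a vector\<close>

lemma transpose_append_zero_mult:
  assumes W: "W \<in> carrier_mat n k" and y: "y \<in> carrier_vec k"
  shows "(W\<^sup>T @\<^sub>c 0\<^sub>m k 1)\<^sup>T *\<^sub>v y = vec_snoc (W *\<^sub>v y) (0 :: real)"
proof (rule eq_vecI)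
  fix i assume i: "i < dim_vec (vec_snoc (W *\<^sub>v y) 0)"
  show "((W\<^sup>T @\<^sub>c 0\<^sub>m k 1)\<^sup>T *\<^sub>v y) $ i = vec_snoc (W *\<^sub>v y) 0 $ i"
  proof (cases "i < n")
    case True
    have "col (W\<^sup>T @\<^sub>c 0\<^sub>m k 1) i = row W i" using True W by (intro eq_vecI) auto
    then show ?thesis using True W y by simp
  next
    case False
    then have "i = n" using i W by simp
    have "col (W\<^sup>T @\<^sub>c 0\<^sub>m k 1) n = 0\<^sub>v k" using W by (intro eq_vecI) auto
    then show ?thesis using \<open>i = n\<close> W y by simp
  qed
qed (use W in auto)

lemma diag_append_zero_mult:
  assumes y: "y \<in> carrier_vec (n + 1)"
  shows "(mat_diag n d @\<^sub>c 0\<^sub>m n 1) *\<^sub>v y = vec n (\<lambda>i. d i * y $ i :: real)"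
proof (rule eq_vecI)
  fix i assume "i < dim_vec (vec n (\<lambda>i. d i * y $ i))"
  then have i: "i < n" by simp
  have "row (mat_diag n d @\<^sub>c 0\<^sub>m n 1) i \<bullet> y = (\<Sum>j\<in>{0..<n + 1}. if i = j then d j * y $ j else 0)"
    using i y unfolding scalar_prod_def by (intro sum.cong) (auto simp: mat_diag_def)
  then show "((mat_diag n d @\<^sub>c 0\<^sub>m n 1) *\<^sub>v y) $ i = vec n (\<lambda>i. d i * y $ i) $ i"
    using i by (simp add: mat_diag_def)
qed (simp add: mat_diag_def)

text \<open>B^T y lists the first n coordinates of (p, 0) in the basis V, weighted by the diagonal
  of D. Its squared norm is therefore a truncated form of the sums in
  \<open>thin_svd_norm\<close>.\<close>

lemma BG_transpose_norm:
  fixes A W :: "real mat" and d :: "nat \<Rightarrow> real"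
  assumes A: "A \<in> carrier_mat m n" and b: "b \<in> carrier_vec m"
    and svd: "thin_svd m (n + 1) (A @\<^sub>c col_mat b) U s V"
    and W: "W \<in> carrier_mat n n" and y: "y \<in> carrier_vec n"
  defines "B \<equiv> mat_diag n d * (W\<^sup>T @\<^sub>c 0\<^sub>m n 1) * V *
      (mat_diag n (\<lambda>i. sqrt ((s i)\<^sup>2 + (s n)\<^sup>2)) @\<^sub>c 0\<^sub>m n 1)\<^sup>T"
    and "p \<equiv> W *\<^sub>v (mat_diag n d *\<^sub>v y)"
  shows "B \<in> carrier_mat n n"
    and "(B\<^sup>T *\<^sub>v y) \<bullet> (B\<^sup>T *\<^sub>v y)
      = (A *\<^sub>v p) \<bullet> (A *\<^sub>v p) + (s n)\<^sup>2 * (p \<bullet> p) - 2 * (s n)\<^sup>2 * (col V n \<bullet> vec_snoc p 0)\<^sup>2"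
proof -
  let ?C = "A @\<^sub>c col_mat b" and ?D = "mat_diag n d" and ?Y = "W\<^sup>T @\<^sub>c 0\<^sub>m n 1"
  let ?Z = "mat_diag n (\<lambda>i. sqrt ((s i)\<^sup>2 + (s n)\<^sup>2)) @\<^sub>c 0\<^sub>m n 1"
  have V: "V \<in> carrier_mat (n + 1) (n + 1)" using svd by (auto simp: thin_svd_def)
  have Y: "?Y \<in> carrier_mat n (n + 1)" and Z: "?Z \<in> carrier_mat n (n + 1)"
    using W by (intro append_cols_carrier; simp)+
  have YT: "?Y\<^sup>T \<in> carrier_mat (n + 1) n" and VT: "V\<^sup>T \<in> carrier_mat (n + 1) (n + 1)"
    using Y V by simp_all
  have DY: "?D * ?Y \<in> carrier_mat n (n + 1)" by (rule mult_carrier_mat[OF mat_diag_dim Y])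
  have DYV: "?D * ?Y * V \<in> carrier_mat n (n + 1)" by (rule mult_carrier_mat[OF DY V])
  have ZT: "?Z\<^sup>T \<in> carrier_mat (n + 1) n" using Z by simp
  show B: "B \<in> carrier_mat n n" unfolding B_def by (rule mult_carrier_mat[OF DYV ZT])
  have Dy: "?D *\<^sub>v y \<in> carrier_vec n" using y by (intro mult_mat_vec_carrier) auto
  have p: "p \<in> carrier_vec n" using W Dy by (simp add: p_def)
  then have p': "vec_snoc p 0 \<in> carrier_vec (n + 1)" by simp
  have "(?D * ?Y)\<^sup>T *\<^sub>v y = ?Y\<^sup>T *\<^sub>v (?D *\<^sub>v y)"
    unfolding transpose_mult[OF mat_diag_dim Y] transpose_mat_diag
    by (rule assoc_mult_mat_vec[OF YT mat_diag_dim y])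
  also have "\<dots> = vec_snoc p 0"
    using transpose_append_zero_mult[OF W Dy] by (simp add: p_def)
  finally have 1: "(?D * ?Y)\<^sup>T *\<^sub>v y = vec_snoc p 0" .
  have 2: "(?D * ?Y * V)\<^sup>T *\<^sub>v y = V\<^sup>T *\<^sub>v vec_snoc p 0"
    unfolding transpose_mult[OF DY V] 1[symmetric]
    by (rule assoc_mult_mat_vec[OF VT _ y]) (use DY in simp)
  have "B\<^sup>T *\<^sub>v y = ?Z *\<^sub>v (V\<^sup>T *\<^sub>v vec_snoc p 0)"
    unfolding B_def transpose_mult[OF DYV ZT] 2[symmetric] transpose_transpose
    by (rule assoc_mult_mat_vec[OF Z _ y]) (use DYV in simp)
  also have "\<dots> = vec n (\<lambda>i. sqrt ((s i)\<^sup>2 + (s n)\<^sup>2) * (V\<^sup>T *\<^sub>v vec_snoc p 0) $ i)"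
    by (rule diag_append_zero_mult[OF mult_mat_vec_carrier[OF VT p']])
  finally have By: "B\<^sup>T *\<^sub>v y = vec n (\<lambda>i. sqrt ((s i)\<^sup>2 + (s n)\<^sup>2) * (V\<^sup>T *\<^sub>v vec_snoc p 0) $ i)" .
  let ?c = "\<lambda>i. (V\<^sup>T *\<^sub>v vec_snoc p 0) $ i"
  have "(B\<^sup>T *\<^sub>v y) \<bullet> (B\<^sup>T *\<^sub>v y) = (\<Sum>i<n. (sqrt ((s i)\<^sup>2 + (s n)\<^sup>2) * ?c i)\<^sup>2)"
    unfolding By scalar_prod_def by (intro sum.cong) (auto simp: power2_eq_square simp del: index_mult_mat_vec)
  also have "\<dots> = (\<Sum>i<n. ((s i)\<^sup>2 + (s n)\<^sup>2) * (?c i)\<^sup>2)"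
    by (simp add: power_mult_distrib del: index_mult_mat_vec)
  \<comment> \<open>The index n is added to complete the sums; its weight would be 2 (s n)^2, which
    is subtracted again.\<close>
  also have "\<dots> = (\<Sum>i<n + 1. (s i)\<^sup>2 * (?c i)\<^sup>2) + (s n)\<^sup>2 * (\<Sum>i<n + 1. (?c i)\<^sup>2) - 2 * (s n)\<^sup>2 * (?c n)\<^sup>2"
    by (simp add: sum.distrib distrib_right sum_distrib_left algebra_simps del: index_mult_mat_vec)
  also have "(\<Sum>i<n + 1. (s i)\<^sup>2 * (?c i)\<^sup>2) = (?C *\<^sub>v vec_snoc p 0) \<bullet> (?C *\<^sub>v vec_snoc p 0)"
    by (rule thin_svd_norm(1)[OF svd p', symmetric])
  also have "?C *\<^sub>v vec_snoc p 0 = A *\<^sub>v p"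
    using A b p by (subst append_col_mult_snoc[OF A b p]) auto
  also have "(\<Sum>i<n + 1. (?c i)\<^sup>2) = vec_snoc p 0 \<bullet> vec_snoc p 0"
    by (rule thin_svd_norm(2)[OF svd p', symmetric])
  also have "vec_snoc p 0 \<bullet> vec_snoc p 0 = p \<bullet> p" using p by (simp add: scalar_prod_snoc[of _ n])
  also have "?c n = col V n \<bullet> vec_snoc p 0" using V by simp
  finally show "(B\<^sup>T *\<^sub>v y) \<bullet> (B\<^sup>T *\<^sub>v y)
      = (A *\<^sub>v p) \<bullet> (A *\<^sub>v p) + (s n)\<^sup>2 * (p \<bullet> p) - 2 * (s n)\<^sup>2 * (col V n \<bullet> vec_snoc p 0)\<^sup>2" .
qed

theorem mainTheorem3:
  fixes m n :: nat
    and A U V Ut Vt :: "real mat"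
    and b x r :: "real vec"
    and s st :: "nat \<Rightarrow> real"
  assumes "m > n"
    and "A \<in> carrier_mat m n"
    and "b \<in> carrier_vec m"
    and "thin_svd m n A Ut st Vt"
    and "thin_svd m (n + 1) (A @\<^sub>c col_mat b) U s V"
    and "st (n - 1) > s n"
    and "tls_solution A b x"
    and "r = b - A *\<^sub>v x"
    and "x \<noteq> 0\<^sub>v n"
    and "r \<noteq> 0\<^sub>v m"
  shows "K_ZLWQ A b x (s n) (col U n) (col V n) = K_BG A b x st Vt s V
    \<and> K_BG A b x st Vt s V = K_LJ A b x (s n)"
proof -
  note A = assms(2) and b = assms(3) and svdA = assms(4) and svd = assms(5) and r_def = assms(8)
  have U: "U \<in> carrier_mat m (n + 1)" and V: "V \<in> carrier_mat (n + 1) (n + 1)" and t0: "0 \<le> s n"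
    using svd by (auto simp: thin_svd_def)
  have Vt: "Vt \<in> carrier_mat n n" "Vt\<^sup>T * Vt = 1\<^sub>m n" using svdA by (auto simp: thin_svd_def)
  have x: "x \<in> carrier_vec n" using assms(7) A by (simp add: tls_solution_def)
  have r: "r \<in> carrier_vec m" using A b x by (simp add: r_def)
  have u: "col U n \<in> carrier_vec m" using U by (intro carrier_vecI) auto
  let ?t = "s n" and ?l = "st (n - 1)" and ?C = "A @\<^sub>c col_mat b"
  have st: "?l \<le> st i" if "i < n" for i
  proof -
    have "i \<le> n - 1 \<and> n - 1 < n" using that by linarith
    then show ?thesis using svdA unfolding thin_svd_def by blast
  qed
  have sq: "?t\<^sup>2 < ?l\<^sup>2" using assms(6) t0 by (intro power_strict_mono) auto
  \<comment> \<open>A stretches every vector at least by its least singular value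
    \<open>st (n - 1)\<close>, which exceeds \<open>s n\<close>.\<close>
  have gap: "?t\<^sup>2 * (z \<bullet> z) < (A *\<^sub>v z) \<bullet> (A *\<^sub>v z)" if z: "z \<in> carrier_vec n" "z \<noteq> 0\<^sub>v n" for z
  proof -
    have "z \<bullet> z > 0" using scalar_prod_self_nonneg[of z] scalar_prod_self_eq_0[OF z(1)] z(2) by fastforce
    then have "?t\<^sup>2 * (z \<bullet> z) < ?l\<^sup>2 * (z \<bullet> z)" using sq by simp
    also have "\<dots> \<le> (A *\<^sub>v z) \<bullet> (A *\<^sub>v z)"
      using st assms(6) t0 by (intro thin_svd_norm_ge[OF svdA z(1)]) auto
    finally show ?thesis .
  qed
  obtain \<alpha> where v: "col V n = \<alpha> \<cdot>\<^sub>v vec_snoc x (- 1)" and \<alpha>: "\<alpha>\<^sup>2 * (x \<bullet> x + 1) = 1"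
    using tls_solution_singular_vector[OF A b svd gap assms(7)] by blast
  have \<alpha>0: "\<alpha> \<noteq> 0" using \<alpha> by auto
  have xs: "vec_snoc x (- 1) \<in> carrier_vec (n + 1)" using x by simp
  \<comment> \<open>Since [A, b] w = A x - b = -r, the singular vector equation for v =
    \<open>\<alpha>\<close> w becomes t u = -\<open>\<alpha>\<close> r; comparing squared lengths
    then gives \<open>rr\<close>.\<close>
  have ur: "?t \<cdot>\<^sub>v col U n = (- \<alpha>) \<cdot>\<^sub>v r"
  proof -
    have "?t \<cdot>\<^sub>v col U n = ?C *\<^sub>v col V n"
      using thin_svd_singular_vectors(1)[OF svd, of n] by simp
    also have "\<dots> = \<alpha> \<cdot>\<^sub>v (A *\<^sub>v x + (- 1) \<cdot>\<^sub>v b)"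
      unfolding v append_col_mult_snoc[OF A b x, symmetric]
      using thin_svd_carrier[OF svd] xs by (intro mult_mat_vec) auto
    also have "\<dots> = (- \<alpha>) \<cdot>\<^sub>v r"
      using A b by (intro eq_vecI) (auto simp: r_def algebra_simps)
    finally show ?thesis .
  qed
  have "\<alpha>\<^sup>2 * (r \<bullet> r) = ((- \<alpha>) \<cdot>\<^sub>v r) \<bullet> ((- \<alpha>) \<cdot>\<^sub>v r)" using r by (simp add: power2_eq_square)
  also have "\<dots> = ?t\<^sup>2"
    unfolding ur[symmetric] using u thin_svd_col_scalar_prod(1)[OF svd, of n]
    by (simp add: power2_eq_square)
  finally have rr: "\<alpha>\<^sup>2 * (r \<bullet> r) = ?t\<^sup>2" .
  \<comment> \<open>Equivalent to (A^T A - t^2 I) x = A^T b. It comes from the first n entries of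
    [A, b]^T u = t v, multiplied by t so that \<open>ur\<close> applies, after cancelling
    \<open>\<alpha>\<close>.\<close>
  have Ar: "A\<^sup>T *\<^sub>v r = (- ?t\<^sup>2) \<cdot>\<^sub>v x"
  proof (rule eq_vecI)
    fix i assume "i < dim_vec ((- ?t\<^sup>2) \<cdot>\<^sub>v x)"
    then have i: "i < n" using x by simp
    have "(?C\<^sup>T *\<^sub>v col U n) $ i = (?t \<cdot>\<^sub>v col V n) $ i"
      using thin_svd_singular_vectors(2)[OF svd, of n] by simp
    moreover have "col ?C i = col A i" using A b i by (intro eq_vecI) auto
    ultimately have "col A i \<bullet> col U n = ?t * (\<alpha> * x $ i)"
      using A b V x i by (simp add: v)
    moreover have cA: "col A i \<in> carrier_vec m" using A by (intro carrier_vecI) simp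
    ultimately have "?t\<^sup>2 * (\<alpha> * x $ i) = col A i \<bullet> (?t \<cdot>\<^sub>v col U n)"
      by (simp add: power2_eq_square scalar_prod_smult_distrib[OF cA u])
    also have "\<dots> = - \<alpha> * (col A i \<bullet> r)" unfolding ur using scalar_prod_smult_distrib[OF cA r] by simp
    finally have "\<alpha> * (col A i \<bullet> r) = \<alpha> * (- ?t\<^sup>2 * x $ i)" by (simp add: algebra_simps)
    then have "col A i \<bullet> r = - ?t\<^sup>2 * x $ i" using mult_left_cancel[OF \<alpha>0] by blast
    then show "(A\<^sup>T *\<^sub>v r) $ i = ((- ?t\<^sup>2) \<cdot>\<^sub>v x) $ i" using A x i by simp
  qed (use A x in auto)
  define d where "d = (\<lambda>i. inverse ((st i)\<^sup>2 - ?t\<^sup>2))"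
  define K where "K = tls_inv A ?t"
  have ne: "(st i)\<^sup>2 \<noteq> ?t\<^sup>2" if "i < n" for i
  proof -
    have "?l\<^sup>2 \<le> (st i)\<^sup>2" using st[OF that] assms(6) t0 by (intro power_mono) auto
    then show ?thesis using sq by simp
  qed
  have K_eq: "K = Vt * mat_diag n d * Vt\<^sup>T"
    unfolding K_def d_def by (rule tls_inv_thin_svd[OF svdA ne])
  have VtT: "Vt\<^sup>T \<in> carrier_mat n n" using Vt by simp
  have VtD: "Vt * mat_diag n d \<in> carrier_mat n n" by (rule mult_carrier_mat[OF Vt(1) mat_diag_dim])
  have K: "K \<in> carrier_mat n n" unfolding K_eq by (rule mult_carrier_mat[OF VtD VtT])
  have K_sym: "K\<^sup>T = K"
    unfolding K_eq transpose_mult[OF VtD VtT] transpose_mult[OF Vt(1) mat_diag_dim]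
    by (simp add: assoc_mult_mat[OF Vt(1) mat_diag_dim VtT])
  let ?Q = "tls_deriv m n A x r (\<alpha>\<^sup>2)"
  let ?B = "mat_diag n d * (Vt\<^sup>T @\<^sub>c 0\<^sub>m n 1) * V *
      (mat_diag n (\<lambda>i. sqrt ((s i)\<^sup>2 + (s n)\<^sup>2)) @\<^sub>c 0\<^sub>m n 1)\<^sup>T"
  have KQ: "K * ?Q \<in> carrier_mat n ((n + 1) * m)" using K tls_deriv_carrier by (rule mult_carrier_mat)
  have B: "?B \<in> carrier_mat n n"
    using BG_transpose_norm(1)[OF A b svd Vt(1) zero_carrier_vec] .
  \<comment> \<open>For p = K z, symmetry of K turns (K Q)^T z into Q^T p, and p is also the vector
    of \<open>BG_transpose_norm\<close> for y = Vt^T z. The relation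
    \<open>\<alpha>\<^sup>2 * (x \<bullet> x + 1) = 1\<close> converts r . r and the coordinate
    along v, leaving the two squared norms in the ratio x . x + 1.\<close>
  have norm: "norm2_vec ((K * ?Q)\<^sup>T *\<^sub>v z) = sqrt (1 + (norm2_vec x)\<^sup>2) * norm2_vec (?B\<^sup>T *\<^sub>v (Vt\<^sup>T *\<^sub>v z))"
    if z: "z \<in> carrier_vec n" for z
  proof -
    have y: "Vt\<^sup>T *\<^sub>v z \<in> carrier_vec n" using VtT z by simp
    define p where "p = Vt *\<^sub>v (mat_diag n d *\<^sub>v (Vt\<^sup>T *\<^sub>v z))"
    have pK: "p = K *\<^sub>v z"
      unfolding p_def K_eq assoc_mult_mat_vec[OF VtD VtT z] assoc_mult_mat_vec[OF Vt(1) mat_diag_dim y] ..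
    have p: "p \<in> carrier_vec n" using K z by (simp add: pK)
    have QT: "?Q\<^sup>T \<in> carrier_mat ((n + 1) * m) n" using tls_deriv_carrier transpose_carrier_mat by blast
    have Lz: "(K * ?Q)\<^sup>T *\<^sub>v z = ?Q\<^sup>T *\<^sub>v p"
      unfolding transpose_mult[OF K tls_deriv_carrier] K_sym pK by (rule assoc_mult_mat_vec[OF QT K z])
    have vp: "col V n \<bullet> vec_snoc p 0 = \<alpha> * (x \<bullet> p)"
      unfolding v using x p by (simp add: scalar_prod_snoc[of _ n] smult_scalar_prod_distrib[of _ "Suc n"])
    let ?c = "x \<bullet> x + 1"
    have rc: "r \<bullet> r = ?c * ?t\<^sup>2"
    proof -
      have "r \<bullet> r = (\<alpha>\<^sup>2 * ?c) * (r \<bullet> r)" using \<alpha> by simp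
      also have "\<dots> = ?c * (\<alpha>\<^sup>2 * (r \<bullet> r))" by (simp only: mult_ac)
      finally show ?thesis by (simp only: rr)
    qed
    have xp: "?c * (2 * ?t\<^sup>2 * (\<alpha> * (x \<bullet> p))\<^sup>2) = 2 * ?t\<^sup>2 * (x \<bullet> p)\<^sup>2"
    proof -
      have "?c * (2 * ?t\<^sup>2 * (\<alpha> * (x \<bullet> p))\<^sup>2) = (\<alpha>\<^sup>2 * ?c) * (2 * ?t\<^sup>2 * (x \<bullet> p)\<^sup>2)"
        by (simp only: power_mult_distrib mult_ac)
      then show ?thesis using \<alpha> by simp
    qed
    have "((K * ?Q)\<^sup>T *\<^sub>v z) \<bullet> ((K * ?Q)\<^sup>T *\<^sub>v z)
      = ?c * ((?B\<^sup>T *\<^sub>v (Vt\<^sup>T *\<^sub>v z)) \<bullet> (?B\<^sup>T *\<^sub>v (Vt\<^sup>T *\<^sub>v z)))"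
      unfolding Lz tls_deriv_transpose_norm[OF A x r p Ar rr \<alpha>]
        BG_transpose_norm(2)[OF A b svd Vt(1) y, of d, folded p_def] vp
      unfolding right_diff_distrib xp by (simp add: rc algebra_simps)
    then show ?thesis
      by (simp add: norm2_vec_def real_sqrt_mult scalar_prod_self_nonneg add.commute)
  qed
  have orth: "Vt\<^sup>T * (Vt\<^sup>T)\<^sup>T = 1\<^sub>m n" using Vt by simp
  have spec: "spectral_norm (K * ?Q) = sqrt (1 + (norm2_vec x)\<^sup>2) * spectral_norm ?B"
    by (rule spectral_norm_eq_scaled_orthogonal[OF KQ B VtT orth _ norm]) simp
  have dims: "dim_row A = m" "dim_col A = n" using A by auto
  have BG: "K_BG A b x st Vt s V = spectral_norm (K * ?Q) * frob_norm ?C / norm2_vec x"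
    unfolding spec K_BG_def Let_def dims d_def by simp
  have LJ: "K_LJ A b x ?t = spectral_norm (K * ?Q) * frob_norm ?C / norm2_vec x"
    unfolding K_LJ_def Let_def dims r_def[symmetric]
      LJ_matrix_eq[OF A x r assms(10) Ar rr] K_def ..
  have ZLWQ: "K_ZLWQ A b x ?t (col U n) (col V n) = spectral_norm (K * ?Q) * frob_norm ?C / norm2_vec x"
    unfolding K_ZLWQ_def
      ZLWQ_matrix_eq[OF A b x r_def K[unfolded K_def] v u ur] K_def ..
  show ?thesis unfolding BG LJ ZLWQ by simp
qed

end
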